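(* Let $Y$ be a (locally finite, connected) transitive graph. Then $$ \beta_1(Y) \leq \frac{h(Y)}{2}.$$
   Context: A graph is transitive if its automorphism group acts transitively on its vertices. For a set $A$ of vertices of a locally finite graph $Y$, $\partial_Y A$ is the set of edges of $Y$ with one extremity in $A$ and the other outside $A$; the isoperimetric constant is $h(Y)=\inf_A|\partial_Y A|/|A|$ over all non-empty finite sets $A$ of vertices of $Y$. The first $\ell^2$-Betti number $\beta_1(Y)$ of a transitive graph is Gaboriau's: fix an orientation of each edge, let $C_1^{(2)}(Y)$ be the Hilbert space of square-summable functions on the edges, with orthonormal basis $(\delta_e)_e$ indexed by the edges, and let $P$ be the orthogonal projection of $C_1^{(2)}(Y)$ onto the closed subspace of square-summable $1$-cycles that are orthogonal to all finitely supported $1$-cycles (equivalently, the gradients of harmonic Dirichlet functions). Then $\beta_1(Y)=\frac12\sum_{e\ni x}\langle P\delta_e,\delta_e\rangle$, the sum being over the edges incident to a vertex $x$ (independent of $x$ by transitivity). When $Y$ is a Cayley graph of a finitely generated group $\Gamma$ with respect to a finite generating set, $\beta_1(Y)=\beta_1(\Gamma)$ is the first $\ell^2$-Betti number of $\Gamma$. *)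

theory Defs
  imports "HOL-Analysis.Analysis"
begin

text \<open>Undirected graphs. Parallel edges and loops are allowed; a simple graph is the case
  where \<open>edges\<close> is a set of two-element sets of vertices and \<open>ends\<close> is the identity.\<close>

record ('v, 'e) graph =
  verts :: "'v set"
  edges :: "'e set"
  ends :: "'e \<Rightarrow> 'v set"

definition wf_graph :: "('v, 'e) graph \<Rightarrow> bool" where
  "wf_graph Y \<longleftrightarrow> (\<forall>e\<in>edges Y. ends Y e \<subseteq> verts Y \<and> card (ends Y e) \<in> {1, 2})"

definition incident_edges :: "('v, 'e) graph \<Rightarrow> 'v \<Rightarrow> 'e set" where
  "incident_edges Y x = {e \<in> edges Y. x \<in> ends Y e}"

definition locally_finite_graph :: "('v, 'e) graph \<Rightarrow> bool" where
  "locally_finite_graph Y \<longleftrightarrow> (\<forall>x\<in>verts Y. finite (incident_edges Y x))"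

definition connected_graph :: "('v, 'e) graph \<Rightarrow> bool" where
  "connected_graph Y \<longleftrightarrow> verts Y \<noteq> {} \<and>
     (\<forall>u\<in>verts Y. \<forall>v\<in>verts Y. (u, v) \<in> {(a, b). \<exists>e\<in>edges Y. ends Y e = {a, b}}\<^sup>*)"

text \<open>Because of parallel edges, an automorphism consists of a vertex map and an edge map.\<close>

definition graph_automorphism ::
    "('v, 'e) graph \<Rightarrow> ('v \<Rightarrow> 'v) \<Rightarrow> ('e \<Rightarrow> 'e) \<Rightarrow> bool" where
  "graph_automorphism Y \<phi> \<psi> \<longleftrightarrow>
     bij_betw \<phi> (verts Y) (verts Y) \<and> bij_betw \<psi> (edges Y) (edges Y) \<and>
     (\<forall>e\<in>edges Y. ends Y (\<psi> e) = \<phi> ` ends Y e)"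

definition transitive_graph :: "('v, 'e) graph \<Rightarrow> bool" where
  "transitive_graph Y \<longleftrightarrow>
     (\<forall>u\<in>verts Y. \<forall>v\<in>verts Y. \<exists>\<phi> \<psi>. graph_automorphism Y \<phi> \<psi> \<and> \<phi> u = v)"

definition edge_boundary :: "('v, 'e) graph \<Rightarrow> 'v set \<Rightarrow> 'e set" where
  "edge_boundary Y A = {e \<in> edges Y. \<exists>u v. ends Y e = {u, v} \<and> u \<in> A \<and> v \<notin> A}"

definition isoperimetric_constant :: "('v, 'e) graph \<Rightarrow> real" where
  "isoperimetric_constant Y =
     (INF A\<in>{A. A \<subseteq> verts Y \<and> finite A \<and> A \<noteq> {}}.
        real (card (edge_boundary Y A)) / real (card A))"

text \<open>An orientation of the edges is a choice of an initial and a terminal extremity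
  of each edge.\<close>

definition orientation :: "('v, 'e) graph \<Rightarrow> ('e \<Rightarrow> 'v) \<Rightarrow> ('e \<Rightarrow> 'v) \<Rightarrow> bool" where
  "orientation Y src tgt \<longleftrightarrow> (\<forall>e\<in>edges Y. ends Y e = {src e, tgt e})"

text \<open>Chains are real-valued functions on the edges, extended by \<open>0\<close> outside the edge set
  so that equality of chains is equality of functions.\<close>

definition l2_chains :: "('v, 'e) graph \<Rightarrow> ('e \<Rightarrow> real) set" where
  "l2_chains Y = {f. (\<forall>e. e \<notin> edges Y \<longrightarrow> f e = 0) \<and> (\<lambda>e. (f e)\<^sup>2) summable_on edges Y}"

definition l2_inner :: "('v, 'e) graph \<Rightarrow> ('e \<Rightarrow> real) \<Rightarrow> ('e \<Rightarrow> real) \<Rightarrow> real" where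
  "l2_inner Y f g = (\<Sum>\<^sub>\<infinity>e\<in>edges Y. f e * g e)"

definition chain_boundary ::
    "('v, 'e) graph \<Rightarrow> ('e \<Rightarrow> 'v) \<Rightarrow> ('e \<Rightarrow> 'v) \<Rightarrow> ('e \<Rightarrow> real) \<Rightarrow> 'v \<Rightarrow> real" where
  "chain_boundary Y src tgt f x =
     (\<Sum>e | e \<in> edges Y \<and> tgt e = x. f e) - (\<Sum>e | e \<in> edges Y \<and> src e = x. f e)"

definition l2_cycles ::
    "('v, 'e) graph \<Rightarrow> ('e \<Rightarrow> 'v) \<Rightarrow> ('e \<Rightarrow> 'v) \<Rightarrow> ('e \<Rightarrow> real) set" where
  "l2_cycles Y src tgt = {f \<in> l2_chains Y. \<forall>x\<in>verts Y. chain_boundary Y src tgt f x = 0}"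

definition finite_cycles ::
    "('v, 'e) graph \<Rightarrow> ('e \<Rightarrow> 'v) \<Rightarrow> ('e \<Rightarrow> 'v) \<Rightarrow> ('e \<Rightarrow> real) set" where
  "finite_cycles Y src tgt = {f \<in> l2_cycles Y src tgt. finite {e. f e \<noteq> 0}}"

definition harmonic_cycles ::
    "('v, 'e) graph \<Rightarrow> ('e \<Rightarrow> 'v) \<Rightarrow> ('e \<Rightarrow> 'v) \<Rightarrow> ('e \<Rightarrow> real) set" where
  "harmonic_cycles Y src tgt =
     {f \<in> l2_cycles Y src tgt. \<forall>g\<in>finite_cycles Y src tgt. l2_inner Y f g = 0}"

text \<open>The orthogonal projection of a square-summable chain \<open>f\<close> onto \<open>H\<close>; it exists and is
  unique when \<open>H\<close> is a closed subspace of \<open>l2_chains Y\<close>.\<close>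

definition l2_proj :: "('v, 'e) graph \<Rightarrow> ('e \<Rightarrow> real) set \<Rightarrow> ('e \<Rightarrow> real) \<Rightarrow> ('e \<Rightarrow> real)" where
  "l2_proj Y H f = (THE p. p \<in> H \<and> (\<forall>g\<in>H. l2_inner Y (\<lambda>e. f e - p e) g = 0))"

text \<open>The sum that defines the first \<open>\<ell>\<^sup>2\<close>-Betti number. It is written at a vertex \<open>x\<close> and with an
  orientation of the edges; on a transitive graph it depends on neither. A loop counts once in
  \<open>incident_edges\<close>, but its term is \<open>0\<close>, since a loop is itself a finitely supported cycle.\<close>

definition l2_betti1 ::
    "('v, 'e) graph \<Rightarrow> ('e \<Rightarrow> 'v) \<Rightarrow> ('e \<Rightarrow> 'v) \<Rightarrow> 'v \<Rightarrow> real" where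
  "l2_betti1 Y src tgt x = 1 / 2 * (\<Sum>e\<in>incident_edges Y x.
     l2_inner Y (l2_proj Y (harmonic_cycles Y src tgt) (indicator {e})) (indicator {e}))"

end

theory Submission
  imports Defs "HOL-Library.Groups_Big_Fun"
begin

text \<open>
  Let \<open>P\<close> be the projection onto the harmonic cycles and \<open>w(e) = \<langle>P \<delta>\<^sub>e, \<delta>\<^sub>e\<rangle>\<close>. Since harmonic cycles
  are orthogonal to all finitely supported gradients and cycles, \<open>w(e) \<le> \<parallel>\<delta>\<^sub>e - u\<parallel>\<^sup>2\<close> for every sum \<open>u\<close> of a
  finitely supported gradient and a finitely supported cycle.

  For the gradient part take \<open>grad k\<^sub>e\<close>, where \<open>k\<^sub>e\<close> is the potential of a unit charge at one end of
  \<open>e\<close> and of the opposite charge at the other end, computed with the Green kernel of the lazy random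
  walk truncated at time \<open>N\<close>. By transitivity the squared distances \<open>\<parallel>\<delta>\<^sub>e - grad k\<^sub>e\<parallel>\<^sup>2\<close> at a
  vertex \<open>x\<close> sum to \<open>deg x - 2 (1 - p(2N))\<close>, where \<open>p(n)\<close> is the return probability after \<open>n\<close> steps.

  Given a finite set \<open>A\<close> of vertices, for the edges inside \<open>A\<close> take in addition the projection of \<open>\<delta>\<^sub>e\<close> onto the
  space of cycles inside \<open>A\<close>. This improves the sum over these edges by the dimension of that space, which
  is at least the number of edges minus the number of vertices. Summing over the vertices of \<open>A\<close> yields
  \<open>2 |A| \<beta>\<^sub>1 \<le> |\<partial>A| + 2 |A| p(2N)\<close>, and \<open>p(2N)\<close> tends to \<open>0\<close> on an infinite graph.
\<close>

section \<open>Square-summable chains\<close>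

text \<open>Bounds on finite partial sums survive edgewise limits;
  \<open>l2_nearest_point_exists\<close> uses this form to see that its limit is
  square-summable.\<close>

lemma l2_chains_iff:
  "f \<in> l2_chains Y \<longleftrightarrow> (\<forall>e. e \<notin> edges Y \<longrightarrow> f e = 0) \<and>
     (\<exists>B. \<forall>F. finite F \<longrightarrow> F \<subseteq> edges Y \<longrightarrow> (\<Sum>e\<in>F. (f e)\<^sup>2) \<le> B)"
proof -
  have "(\<lambda>e. (f e)\<^sup>2) summable_on edges Y"
    if "\<forall>F. finite F \<longrightarrow> F \<subseteq> edges Y \<longrightarrow> (\<Sum>e\<in>F. (f e)\<^sup>2) \<le> B" for B
    using that by (intro nonneg_bdd_above_summable_on) (auto simp: bdd_above_def)
  moreover have "(\<Sum>e\<in>F. (f e)\<^sup>2) \<le> (\<Sum>\<^sub>\<infinity>e\<in>edges Y. (f e)\<^sup>2)"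
    if "(\<lambda>e. (f e)\<^sup>2) summable_on edges Y" "finite F" "F \<subseteq> edges Y" for F
    using that by (intro finite_sum_le_infsum) auto
  ultimately show ?thesis unfolding l2_chains_def by blast
qed

lemma l2_prod_summable:
  assumes "f \<in> l2_chains Y" "g \<in> l2_chains Y"
  shows "(\<lambda>e. f e * g e) summable_on edges Y"
proof -
  have "(\<lambda>e. (f e)\<^sup>2 + (g e)\<^sup>2) summable_on edges Y"
    using assms by (auto simp: l2_chains_def intro: summable_on_add)
  moreover have "norm (f e * g e) \<le> (f e)\<^sup>2 + (g e)\<^sup>2" for e
  proof -
    have "2 * (\<bar>f e\<bar> * \<bar>g e\<bar>) \<le> (f e)\<^sup>2 + (g e)\<^sup>2"
      using sum_squares_bound[of "\<bar>f e\<bar>" "\<bar>g e\<bar>"] by (simp add: mult.assoc)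
    moreover have "0 \<le> \<bar>f e\<bar> * \<bar>g e\<bar>" by simp
    ultimately have "\<bar>f e\<bar> * \<bar>g e\<bar> \<le> (f e)\<^sup>2 + (g e)\<^sup>2" by linarith
    then show ?thesis by (simp add: abs_mult)
  qed
  ultimately have "(\<lambda>e. norm (f e * g e)) summable_on edges Y"
    by (rule summable_on_comparison_test) auto
  then show ?thesis by (rule abs_summable_summable)
qed

lemma l2_chains_lincomb:
  assumes "f \<in> l2_chains Y" "g \<in> l2_chains Y"
  shows "(\<lambda>e. a * f e + b * g e) \<in> l2_chains Y"
proof -
  have "(\<lambda>e. (a\<^sup>2 * (f e * f e) + (2 * a * b) * (f e * g e)) + b\<^sup>2 * (g e * g e)) summable_on edges Y"
    by (intro summable_on_add summable_on_cmult_right l2_prod_summable assms)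
  moreover have "(\<lambda>e. (a * f e + b * g e)\<^sup>2) =
      (\<lambda>e. (a\<^sup>2 * (f e * f e) + (2 * a * b) * (f e * g e)) + b\<^sup>2 * (g e * g e))"
    by (auto simp: power2_eq_square algebra_simps)
  ultimately show ?thesis using assms by (simp add: l2_chains_def)
qed

lemma l2_inner_commute: "l2_inner Y f g = l2_inner Y g f"
  by (simp add: l2_inner_def mult.commute)

lemma l2_inner_lincomb_left:
  assumes "f \<in> l2_chains Y" "g \<in> l2_chains Y" "h \<in> l2_chains Y"
  shows "l2_inner Y (\<lambda>e. a * f e + b * g e) h = a * l2_inner Y f h + b * l2_inner Y g h"
proof -
  have "l2_inner Y (\<lambda>e. a * f e + b * g e) h =
      (\<Sum>\<^sub>\<infinity>e\<in>edges Y. a * (f e * h e) + b * (g e * h e))"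
    by (simp add: l2_inner_def algebra_simps)
  also have "\<dots> = (\<Sum>\<^sub>\<infinity>e\<in>edges Y. a * (f e * h e)) + (\<Sum>\<^sub>\<infinity>e\<in>edges Y. b * (g e * h e))"
    by (intro infsum_add summable_on_cmult_right l2_prod_summable assms)
  finally show ?thesis by (simp add: l2_inner_def infsum_cmult_right')
qed

lemma l2_inner_lincomb_right:
  assumes "f \<in> l2_chains Y" "g \<in> l2_chains Y" "h \<in> l2_chains Y"
  shows "l2_inner Y h (\<lambda>e. a * f e + b * g e) = a * l2_inner Y h f + b * l2_inner Y h g"
  using l2_inner_lincomb_left[OF assms] by (simp add: l2_inner_commute)

lemma l2_inner_self_nonneg: "0 \<le> l2_inner Y f f"
  unfolding l2_inner_def by (intro infsum_nonneg) auto

lemma l2_norm_lincomb: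
  assumes "f \<in> l2_chains Y" "g \<in> l2_chains Y"
  shows "l2_inner Y (\<lambda>e. a * f e + b * g e) (\<lambda>e. a * f e + b * g e) =
    a\<^sup>2 * l2_inner Y f f + 2 * a * b * l2_inner Y f g + b\<^sup>2 * l2_inner Y g g"
  using assms
  by (simp add: l2_inner_lincomb_left l2_inner_lincomb_right l2_chains_lincomb
      l2_inner_commute[of Y g f] algebra_simps power2_eq_square)

lemma sum_squares_le_l2_inner:
  assumes "f \<in> l2_chains Y" "finite F" "F \<subseteq> edges Y"
  shows "(\<Sum>e\<in>F. (f e)\<^sup>2) \<le> l2_inner Y f f"
  using assms unfolding l2_inner_def power2_eq_square[symmetric]
  by (intro finite_sum_le_infsum) (auto simp: l2_chains_def)

lemma l2_inner_finite_support:
  assumes "finite F" "F \<subseteq> edges Y" "\<And>e. e \<in> edges Y - F \<Longrightarrow> f e * g e = 0"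
  shows "l2_inner Y f g = (\<Sum>e\<in>F. f e * g e)"
proof -
  have "l2_inner Y f g = (\<Sum>\<^sub>\<infinity>e\<in>F. f e * g e)"
    unfolding l2_inner_def using assms by (intro infsum_cong_neutral) auto
  then show ?thesis using assms by simp
qed

lemma finite_support_l2:
  assumes "finite {e. f e \<noteq> 0}" "\<And>e. e \<notin> edges Y \<Longrightarrow> f e = 0"
  shows "f \<in> l2_chains Y"
proof -
  have "(\<lambda>e. (f e)\<^sup>2) summable_on edges Y \<longleftrightarrow> (\<lambda>e. (f e)\<^sup>2) summable_on {e. f e \<noteq> 0}"
    using assms by (intro summable_on_cong_neutral) auto
  then show ?thesis using assms by (simp add: l2_chains_def)
qed

lemma indicator_l2: "e \<in> edges Y \<Longrightarrow> indicator {e} \<in> l2_chains Y"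
  by (intro finite_support_l2) (auto simp: indicator_def)

lemma l2_inner_indicator:
  assumes "e \<in> edges Y"
  shows "l2_inner Y f (indicator {e}) = f e"
  using assms by (subst l2_inner_finite_support[of "{e}"]) auto

text \<open>A minimizing sequence is Cauchy at each edge by the parallelogram law, and its edgewise
  limit is a minimizer. Accordingly \<open>closed\<close> is phrased with edgewise limits, which
  suits conditions given by finite sums, such as those that define harmonic cycles.\<close>

lemma l2_nearest_point_exists:
  assumes f: "f \<in> l2_chains Y" and H: "H \<subseteq> l2_chains Y" "H \<noteq> {}"
    and lin: "\<And>g h a b. g \<in> H \<Longrightarrow> h \<in> H \<Longrightarrow> (\<lambda>e. a * g e + b * h e) \<in> H"
    and closed: "\<And>s g. (\<And>n. s n \<in> H) \<Longrightarrow> (\<And>e. (\<lambda>n. s n e) \<longlonglongrightarrow> g e) \<Longrightarrow> g \<in> l2_chains Y \<Longrightarrow> g \<in> H"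
  shows "\<exists>p\<in>H. \<forall>h\<in>H. l2_inner Y (\<lambda>e. f e - p e) (\<lambda>e. f e - p e)
                     \<le> l2_inner Y (\<lambda>e. f e - h e) (\<lambda>e. f e - h e)"
proof -
  define J where "J h = l2_inner Y (\<lambda>e. f e - h e) (\<lambda>e. f e - h e)" for h
  define d where "d = (INF h\<in>H. J h)"
  have J0: "0 \<le> J h" for h by (simp add: J_def l2_inner_self_nonneg)
  have bdd: "bdd_below (J ` H)" using J0 by (auto simp: bdd_below_def)
  have dle: "d \<le> J h" if "h \<in> H" for h
    unfolding d_def using that bdd by (rule cINF_lower[rotated])
  have "\<exists>h\<in>H. J h < d + inverse (real (Suc n))" for n
    using cINF_less_iff[OF H(2) bdd, of "d + inverse (real (Suc n))"]
    by (simp add: d_def[symmetric])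
  then obtain s where s: "\<And>n. s n \<in> H" "\<And>n. J (s n) < d + inverse (real (Suc n))"
    by metis
  have sl2: "s n \<in> l2_chains Y" for n using s H by blast
  have diffl2: "(\<lambda>e. f e - h e) \<in> l2_chains Y" if "h \<in> l2_chains Y" for h
    using l2_chains_lincomb[OF f that, of 1 "-1"] by simp
  \<comment> \<open>Parallelogram law for \<open>?g\<close> and \<open>?h\<close>: the midpoint
    \<open>?m\<close> lies in \<open>H\<close>, so \<open>J ?m\<close> is at least
    \<open>d\<close>.\<close>
  have par: "l2_inner Y (\<lambda>e. g e - h e) (\<lambda>e. g e - h e) \<le> 2 * J g + 2 * J h - 4 * d"
    if "g \<in> H" "h \<in> H" for g h
  proof -
    let ?g = "\<lambda>e. f e - g e" and ?h = "\<lambda>e. f e - h e" and ?m = "\<lambda>e. 1/2 * g e + 1/2 * h e"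
    have gh: "?g \<in> l2_chains Y" "?h \<in> l2_chains Y" using that H diffl2 by blast+
    have eq1: "(\<lambda>e. f e - ?m e) = (\<lambda>e. 1/2 * ?g e + 1/2 * ?h e)"
      by (rule ext) (simp add: field_simps)
    have eq2: "(\<lambda>e. g e - h e) = (\<lambda>e. (-1) * ?g e + 1 * ?h e)" by auto
    have "d \<le> J ?m" using lin[OF that, of "1/2" "1/2"] dle by blast
    then show ?thesis
      unfolding J_def eq1 eq2 l2_norm_lincomb[OF gh] by (simp add: power2_eq_square)
  qed
  have sq: "(s n e - s m e)\<^sup>2 \<le> 2 * inverse (real (Suc n)) + 2 * inverse (real (Suc m))" for n m e
  proof (cases "e \<in> edges Y")
    case True
    have "(\<lambda>e. s n e - s m e) \<in> l2_chains Y"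
      using l2_chains_lincomb[OF sl2 sl2, of 1 n "-1" m] by simp
    from sum_squares_le_l2_inner[OF this, of "{e}"] True par[OF s(1) s(1), of n m] s(2)[of n] s(2)[of m]
    show ?thesis by simp
  next
    case False
    then show ?thesis using sl2 by (auto simp: l2_chains_def)
  qed
  have "Cauchy (\<lambda>n. s n e)" for e
  proof (rule metric_CauchyI)
    fix \<epsilon> :: real assume e: "\<epsilon> > 0"
    then obtain M where M: "inverse (real (Suc M)) < \<epsilon>\<^sup>2 / 4"
      using reals_Archimedean[of "\<epsilon>\<^sup>2 / 4"] by auto
    have "dist (s m e) (s n e) < \<epsilon>" if "m \<ge> M" "n \<ge> M" for m n
    proof -
      have "inverse (real (Suc m)) \<le> inverse (real (Suc M))" "inverse (real (Suc n)) \<le> inverse (real (Suc M))"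
        using that by (auto intro!: le_imp_inverse_le)
      then have "(s m e - s n e)\<^sup>2 < \<epsilon>\<^sup>2" using sq[where n=m and m=n and e=e] M by linarith
      then have "\<bar>s m e - s n e\<bar> < \<epsilon>"
        using power2_less_imp_less[of "\<bar>s m e - s n e\<bar>" \<epsilon>] e by simp
      then show ?thesis by (simp add: dist_real_def)
    qed
    then show "\<exists>M. \<forall>m\<ge>M. \<forall>n\<ge>M. dist (s m e) (s n e) < \<epsilon>" by blast
  qed
  then have "convergent (\<lambda>n. s n e)" for e by (rule Cauchy_convergent)
  then have p: "(\<lambda>n. s n e) \<longlonglongrightarrow> lim (\<lambda>n. s n e)" for e
    by (rule convergent_LIMSEQ_iff[THEN iffD1])
  define p where "p e = lim (\<lambda>n. s n e)" for e
  note p = p[folded p_def]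
  \<comment> \<open>As in Fatou's lemma, the bound is first proved for finite partial sums, where
    the limit in \<open>n\<close> can be taken term by term.\<close>
  have fin: "(\<Sum>e\<in>F. (f e - p e)\<^sup>2) \<le> d" if "finite F" "F \<subseteq> edges Y" for F
  proof (rule LIMSEQ_le)
    show "(\<lambda>n. \<Sum>e\<in>F. (f e - s n e)\<^sup>2) \<longlonglongrightarrow> (\<Sum>e\<in>F. (f e - p e)\<^sup>2)"
      by (intro tendsto_intros p)
    show "(\<lambda>n. d + inverse (real (Suc n))) \<longlonglongrightarrow> d"
      by (rule LIMSEQ_inverse_real_of_nat_add)
    have "(\<Sum>e\<in>F. (f e - s n e)\<^sup>2) \<le> d + inverse (real (Suc n))" for n
      using sum_squares_le_l2_inner[OF diffl2[OF sl2[of n]] that] s(2)[of n]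
      by (auto simp: J_def)
    then show "\<exists>N. \<forall>n\<ge>N. (\<Sum>e\<in>F. (f e - s n e)\<^sup>2) \<le> d + inverse (real (Suc n))" by blast
  qed
  have p0: "p e = 0" if "e \<notin> edges Y" for e
    using p[of e] sl2 that by (auto simp: l2_chains_def LIMSEQ_const_iff)
  have fp: "(\<lambda>e. f e - p e) \<in> l2_chains Y"
    using f p0 fin by (auto simp: l2_chains_iff)
  have "p \<in> l2_chains Y" using l2_chains_lincomb[OF f fp, of 1 "-1"] by simp
  with s(1) p have pH: "p \<in> H" by (rule closed)
  have "J p \<le> d" unfolding J_def l2_inner_def
    using fp fin
    by (intro infsum_le_finite_sums) (auto simp: power2_eq_square[symmetric] l2_chains_def)
  then have "J p \<le> J h" if "h \<in> H" for h using dle[OF that] by linarith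
  with pH show ?thesis unfolding J_def by blast
qed

text \<open>Varying the nearest point along \<open>H\<close> gives the orthogonality; uniqueness
  makes the \<open>THE\<close> in \<open>l2_proj\<close> denote this point.\<close>

lemma l2_proj_spec:
  assumes f: "f \<in> l2_chains Y" and H: "H \<subseteq> l2_chains Y" "H \<noteq> {}"
    and lin: "\<And>g h a b. g \<in> H \<Longrightarrow> h \<in> H \<Longrightarrow> (\<lambda>e. a * g e + b * h e) \<in> H"
    and closed: "\<And>s g. (\<And>n. s n \<in> H) \<Longrightarrow> (\<And>e. (\<lambda>n. s n e) \<longlonglongrightarrow> g e) \<Longrightarrow> g \<in> l2_chains Y \<Longrightarrow> g \<in> H"
  shows "l2_proj Y H f \<in> H \<and> (\<forall>g\<in>H. l2_inner Y (\<lambda>e. f e - l2_proj Y H f e) g = 0)"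
proof -
  obtain p where pH: "p \<in> H" and min: "\<And>h. h \<in> H \<Longrightarrow>
      l2_inner Y (\<lambda>e. f e - p e) (\<lambda>e. f e - p e) \<le> l2_inner Y (\<lambda>e. f e - h e) (\<lambda>e. f e - h e)"
  proof -
    have "\<exists>p\<in>H. \<forall>h\<in>H. l2_inner Y (\<lambda>e. f e - p e) (\<lambda>e. f e - p e)
                     \<le> l2_inner Y (\<lambda>e. f e - h e) (\<lambda>e. f e - h e)"
      by (intro l2_nearest_point_exists f H; fact)
    then show thesis using that by blast
  qed
  have diffl2: "(\<lambda>e. f e - h e) \<in> l2_chains Y" if "h \<in> H" for h
    using l2_chains_lincomb[OF f, of h 1 "-1"] that H by auto
  have orth: "l2_inner Y (\<lambda>e. f e - p e) g = 0" if g: "g \<in> H" for g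
  proof -
    let ?r = "\<lambda>e. f e - p e"
    define I N where "I = l2_inner Y ?r g" and "N = l2_inner Y g g"
    have *: "0 \<le> - 2 * t * I + t\<^sup>2 * N" for t
    proof -
      have eq: "(\<lambda>e. f e - (1 * p e + t * g e)) = (\<lambda>e. 1 * ?r e + (- t) * g e)"
        by (auto simp: algebra_simps)
      have "l2_inner Y ?r ?r \<le> l2_inner Y (\<lambda>e. 1 * ?r e + (- t) * g e) (\<lambda>e. 1 * ?r e + (- t) * g e)"
        using min[OF lin[OF pH g, of 1 t]] unfolding eq .
      also have "\<dots> = l2_inner Y ?r ?r - 2 * t * I + t\<^sup>2 * N"
        using g H by (subst l2_norm_lincomb[OF diffl2[OF pH]]) (auto simp: I_def N_def)
      finally show ?thesis by simp
    qed
    have N: "N \<ge> 0" by (simp add: N_def l2_inner_self_nonneg)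
    \<comment> \<open>With this \<open>t\<close> the inequality \<open>*\<close> becomes
      \<open>t^2 * (N + 2) <= 0\<close>. The summand 1 keeps the denominator positive when
      \<open>g\<close> has norm 0.\<close>
    define t where "t = I / (N + 1)"
    have It: "I = t * (N + 1)" using N by (simp add: t_def)
    have "t\<^sup>2 * (N + 2) \<le> 0"
      using *[of t] unfolding It by (simp add: power2_eq_square algebra_simps)
    then have "t = 0" using N by (simp add: mult_le_0_iff)
    then have "I = 0" using It by simp
    then show ?thesis by (simp add: I_def)
  qed
  have uniq: "q = p" if "q \<in> H" and q: "\<forall>g\<in>H. l2_inner Y (\<lambda>e. f e - q e) g = 0" for q
  proof -
    \<comment> \<open>The difference of two solutions lies in \<open>H\<close> and is orthogonal to
      itself.\<close>
    let ?g = "\<lambda>e. 1 * p e + (- 1) * q e"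
    have gH: "?g \<in> H" by (rule lin[OF pH that(1)])
    have "?g = (\<lambda>e. 1 * (f e - q e) + (- 1) * (f e - p e))" by auto
    then have "l2_inner Y ?g ?g = l2_inner Y (\<lambda>e. 1 * (f e - q e) + (- 1) * (f e - p e)) ?g"
      by simp
    also have "\<dots> = 0"
      using H gH pH that orth[OF gH] q diffl2
      by (subst l2_inner_lincomb_left) (auto simp: subset_iff)
    finally have 0: "l2_inner Y ?g ?g = 0" .
    have "p e = q e" for e
    proof (cases "e \<in> edges Y")
      case True
      then show ?thesis using sum_squares_le_l2_inner[of ?g Y "{e}"] gH H 0 by auto
    next
      case False
      moreover have "p \<in> l2_chains Y" "q \<in> l2_chains Y" using H pH that(1) by blast+
      ultimately show ?thesis by (simp add: l2_chains_def)
    qed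
    then show ?thesis by auto
  qed
  have "l2_proj Y H f = p"
    unfolding l2_proj_def
  proof (rule the_equality)
    show "p \<in> H \<and> (\<forall>g\<in>H. l2_inner Y (\<lambda>e. f e - p e) g = 0)"
      by (intro conjI ballI pH orth)
  qed (elim conjE, rule uniq)
  with pH orth show ?thesis by blast
qed

text \<open>\<open>z\<close> is the orthogonal projection of \<open>\<real>\<^sup>E\<close> onto the orthogonal complement of the \<open>r x\<close>; its
  trace is the dimension of that complement.\<close>

lemma finite_complement_projection:
  fixes r :: "'v \<Rightarrow> 'e \<Rightarrow> real"
  assumes "finite A" "finite E"
  shows "\<exists>z. (\<forall>e\<in>E. \<forall>f\<in>E. z e f = z f e) \<and> (\<forall>e\<in>E. \<forall>f\<in>E. (\<Sum>g\<in>E. z e g * z g f) = z e f)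
    \<and> (\<forall>x\<in>A. \<forall>e\<in>E. (\<Sum>g\<in>E. z e g * r x g) = 0) \<and> real (card E) - real (card A) \<le> (\<Sum>e\<in>E. z e e)"
proof -
  define P where "P A z \<longleftrightarrow> (\<forall>e\<in>E. \<forall>f\<in>E. z e f = z f e) \<and>
    (\<forall>e\<in>E. \<forall>f\<in>E. (\<Sum>g\<in>E. z e g * z g f) = z e f) \<and>
    (\<forall>x\<in>A. \<forall>e\<in>E. (\<Sum>g\<in>E. z e g * r x g) = 0) \<and>
    real (card E) - real (card A) \<le> (\<Sum>e\<in>E. z e e)" for A z
  have "\<exists>z. P A z" using assms(1)
  proof induction
    case empty
    have delta: "(\<Sum>g\<in>E. (if e = g then 1 else 0) * h g) = h e" if "e \<in> E" for e and h :: "'e \<Rightarrow> real"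
    proof -
      have "(\<Sum>g\<in>E. (if e = g then 1 else 0) * h g) = (\<Sum>g\<in>E. if e = g then h g else 0)"
        by (intro sum.cong) auto
      then show ?thesis using that assms(2) by simp
    qed
    have "P {} (\<lambda>e f. if e = f then 1 else 0)"
      unfolding P_def by (auto simp: delta)
    then show ?case by blast
  next
    case (insert y A)
    then obtain z where z: "P A z" by blast
    have sym: "z e f = z f e" and idem: "(\<Sum>g\<in>E. z e g * z g f) = z e f"
      if "e \<in> E" "f \<in> E" for e f
      using z that unfolding P_def by blast+
    have orth: "(\<Sum>g\<in>E. z e g * r x g) = 0" if "x \<in> A" "e \<in> E" for x e
      using z that unfolding P_def by blast
    have tr: "real (card E) - real (card A) \<le> (\<Sum>e\<in>E. z e e)"
      using z unfolding P_def by blast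
    \<comment> \<open>One Gram-Schmidt step: \<open>q\<close> is the projection of
      \<open>r y\<close> onto the current complement and \<open>N\<close> is its squared norm. If
      \<open>N = 0\<close>, the complement is already orthogonal to \<open>r y\<close> and
      \<open>z\<close> is kept; otherwise the projection onto the line of \<open>q\<close> is
      subtracted, which lowers the trace by exactly one.\<close>
    define q where "q e = (\<Sum>g\<in>E. z e g * r y g)" for e
    define N where "N = (\<Sum>e\<in>E. (q e)\<^sup>2)"
    have zq: "(\<Sum>g\<in>E. z e g * q g) = q e" if "e \<in> E" for e
    proof -
      have "(\<Sum>g\<in>E. z e g * q g) = (\<Sum>g\<in>E. \<Sum>f\<in>E. z e g * z g f * r y f)"
        by (simp add: q_def sum_distrib_left mult.assoc)
      also have "\<dots> = (\<Sum>f\<in>E. (\<Sum>g\<in>E. z e g * z g f) * r y f)"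
        by (subst sum.swap) (simp add: sum_distrib_right)
      finally show ?thesis using idem that by (simp add: q_def)
    qed
    have qr: "(\<Sum>g\<in>E. q g * r x g) = 0" if "x \<in> A" for x
    proof -
      have "(\<Sum>g\<in>E. q g * r x g) = (\<Sum>g\<in>E. \<Sum>f\<in>E. z g f * r y f * r x g)"
        by (simp add: q_def sum_distrib_right)
      also have "\<dots> = (\<Sum>f\<in>E. r y f * (\<Sum>g\<in>E. z f g * r x g))"
        by (subst sum.swap) (auto simp: sum_distrib_left sym mult_ac intro!: sum.cong)
      finally show ?thesis using orth that by simp
    qed
    have qy: "(\<Sum>g\<in>E. q g * r y g) = N"
    proof -
      have "(\<Sum>g\<in>E. q g * r y g) = (\<Sum>g\<in>E. (\<Sum>f\<in>E. z g f * q f) * r y g)"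
        using zq by simp
      also have "\<dots> = (\<Sum>f\<in>E. q f * (\<Sum>g\<in>E. z f g * r y g))"
        unfolding sum_distrib_right sum_distrib_left
        by (subst sum.swap) (auto simp: sym mult_ac intro!: sum.cong)
      finally show ?thesis by (simp add: N_def q_def power2_eq_square)
    qed
    show ?case
    proof (cases "N = 0")
      case True
      then have "\<forall>e\<in>E. q e = 0" using assms(2) by (simp add: N_def sum_nonneg_eq_0_iff)
      then have "P (insert y A) z"
        using z insert.hyps by (auto simp: P_def q_def)
      then show ?thesis by blast
    next
      case False
      let ?z = "\<lambda>e f. z e f - q e * q f / N"
      have 1: "(\<Sum>g\<in>E. ?z e g * ?z g f) = ?z e f" if "e \<in> E" "f \<in> E" for e f
      proof -
        have "(\<Sum>g\<in>E. ?z e g * ?z g f) = (\<Sum>g\<in>E. z e g * z g f) - (\<Sum>g\<in>E. z e g * q g) * q f / N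
            - q e / N * (\<Sum>g\<in>E. z f g * q g) + q e * q f / N / N * (\<Sum>g\<in>E. (q g)\<^sup>2)"
          unfolding sum_distrib_left sum_distrib_right sum_divide_distrib
            sum.distrib[symmetric] sum_subtractf[symmetric]
        proof (intro sum.cong refl)
          fix g assume "g \<in> E"
          then show "?z e g * ?z g f = z e g * z g f - z e g * q g * q f / N - q e / N * (z f g * q g)
              + q e * q f / N / N * (q g)\<^sup>2"
            using sym[of g f] that False by (simp add: field_simps power2_eq_square)
        qed
        then show ?thesis using zq idem that False by (simp add: N_def[symmetric])
      qed
      have 2: "(\<Sum>g\<in>E. ?z e g * r x g) = 0" if "x \<in> insert y A" "e \<in> E" for x e
      proof -
        have "(\<Sum>g\<in>E. ?z e g * r x g) = (\<Sum>g\<in>E. z e g * r x g) - q e / N * (\<Sum>g\<in>E. q g * r x g)"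
          unfolding sum_distrib_left sum_subtractf[symmetric]
          by (intro sum.cong) (auto simp: algebra_simps)
        then show ?thesis using that qr qy orth False by (auto simp: q_def)
      qed
      have "(\<Sum>e\<in>E. ?z e e) = (\<Sum>e\<in>E. z e e) - 1"
        using False by (simp add: sum_subtractf power2_eq_square[symmetric] sum_divide_distrib[symmetric] N_def[symmetric])
      then have tr': "real (card E) - real (card (insert y A)) \<le> (\<Sum>e\<in>E. ?z e e)"
        using tr insert.hyps by simp
      have "?z e f = ?z f e" if "e \<in> E" "f \<in> E" for e f
        using sym[OF that] by (simp add: mult.commute)
      then have "P (insert y A) ?z"
        unfolding P_def using 1 2 tr' by blast
      then show ?thesis by blast
    qed
  qed
  then show ?thesis unfolding P_def .
qed

section \<open>Gradients and the Laplacian\<close>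

locale oriented_graph =
  fixes Y :: "('v, 'e) graph" and src tgt :: "'e \<Rightarrow> 'v"
  assumes wf: "wf_graph Y"
    and locally_finite: "locally_finite_graph Y"
    and orient: "orientation Y src tgt"
begin

abbreviation "inc \<equiv> incident_edges Y"
abbreviation "bd \<equiv> chain_boundary Y src tgt"

definition grad :: "('v \<Rightarrow> real) \<Rightarrow> 'e \<Rightarrow> real" where
  "grad f e = f (tgt e) - f (src e)"

definition lap :: "('v \<Rightarrow> real) \<Rightarrow> 'v \<Rightarrow> real" where
  "lap f = bd (grad f)"

text \<open>For a loop at \<open>x\<close> this is \<open>x\<close> itself, so loops contribute 0 in
  \<open>lap_eq\<close>.\<close>

definition other :: "'e \<Rightarrow> 'v \<Rightarrow> 'v" where
  "other e x = (if src e = x then tgt e else src e)"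

lemma ends_eq: "e \<in> edges Y \<Longrightarrow> ends Y e = {src e, tgt e}"
  using orient by (auto simp: orientation_def)

lemma src_in_verts: "e \<in> edges Y \<Longrightarrow> src e \<in> verts Y"
  and tgt_in_verts: "e \<in> edges Y \<Longrightarrow> tgt e \<in> verts Y"
  using wf ends_eq by (auto simp: wf_graph_def)

lemma mem_inc: "e \<in> inc x \<longleftrightarrow> e \<in> edges Y \<and> (src e = x \<or> tgt e = x)"
  using ends_eq by (auto simp: incident_edges_def)

lemma inc_subset: "inc x \<subseteq> edges Y"
  by (auto simp: incident_edges_def)

lemma inc_outside: "x \<notin> verts Y \<Longrightarrow> inc x = {}"
  using src_in_verts tgt_in_verts by (auto simp: mem_inc)

lemma finite_inc [simp]: "finite (inc x)"
  using locally_finite inc_outside by (cases "x \<in> verts Y") (auto simp: locally_finite_graph_def)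

lemma other_in_inc: "e \<in> inc x \<Longrightarrow> e \<in> inc (other e x)"
  by (auto simp: mem_inc other_def)

lemma other_in_verts: "e \<in> inc x \<Longrightarrow> other e x \<in> verts Y"
  by (auto simp: mem_inc other_def src_in_verts tgt_in_verts)

text \<open>Writes boundaries at different vertices as sums over one common finite edge set, so that
  sums over vertices and edges can be exchanged.\<close>

lemma bd_eq:
  assumes "finite F" "F \<subseteq> edges Y" "\<And>e. e \<in> inc x \<Longrightarrow> e \<notin> F \<Longrightarrow> h e = 0"
  shows "bd h x = (\<Sum>e\<in>F. (if tgt e = x then h e else 0) - (if src e = x then h e else 0))"
proof -
  have *: "(\<Sum>e\<in>F. if t e = x then h e else 0) = (\<Sum>e | e \<in> edges Y \<and> t e = x. h e)"
    if "{e \<in> edges Y. t e = x} \<subseteq> inc x" for t :: "'e \<Rightarrow> 'v"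
  proof -
    have "(\<Sum>e\<in>F. if t e = x then h e else 0) = (\<Sum>e\<in>F \<inter> {e. t e = x}. h e)"
      using assms(1) by (simp add: sum.inter_restrict)
    also have "\<dots> = (\<Sum>e | e \<in> edges Y \<and> t e = x. h e)"
      using assms that finite_subset[OF that finite_inc] by (intro sum.mono_neutral_left) auto
    finally show ?thesis .
  qed
  show ?thesis
    unfolding chain_boundary_def sum_subtractf
    by (subst (1 2) *) (auto simp: mem_inc)
qed

text \<open>Summation by parts: gradient and boundary are adjoint. Outside \<open>F\<close>,
  \<open>h\<close> has to vanish only on edges that meet \<open>X\<close>, so it may have infinite
  support, as harmonic cycles do.\<close>

lemma green:
  assumes X: "finite X" and F: "finite F" "F \<subseteq> edges Y" and k: "\<And>x. x \<notin> X \<Longrightarrow> k x = 0"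
    and h: "\<And>e x. x \<in> X \<Longrightarrow> e \<in> inc x \<Longrightarrow> e \<notin> F \<Longrightarrow> h e = 0"
  shows "(\<Sum>e\<in>F. grad k e * h e) = (\<Sum>x\<in>X. k x * bd h x)"
proof -
  have "(\<Sum>x\<in>X. k x * bd h x) = (\<Sum>x\<in>X. \<Sum>e\<in>F.
      (if tgt e = x then k x * h e else 0) - (if src e = x then k x * h e else 0))"
    using h by (intro sum.cong refl) (auto simp: bd_eq[OF F] sum_distrib_left intro!: sum.cong)
  also have "\<dots> = (\<Sum>e\<in>F. \<Sum>x\<in>X.
      (if tgt e = x then k x * h e else 0) - (if src e = x then k x * h e else 0))"
    by (rule sum.swap)
  also have "\<dots> = (\<Sum>e\<in>F. grad k e * h e)"
    using k X by (intro sum.cong refl) (auto simp: sum_subtractf grad_def algebra_simps)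
  finally show ?thesis by simp
qed

lemma lap_eq: "lap f x = (\<Sum>e\<in>inc x. f x - f (other e x))"
  unfolding lap_def
  by (subst bd_eq[of "inc x"]) (auto simp: inc_subset mem_inc other_def grad_def intro!: sum.cong)

lemma lap_lin: "lap (\<lambda>x. a * f x + b * g x) x = a * lap f x + b * lap g x"
  by (simp add: lap_eq sum_distrib_left sum.distrib[symmetric] algebra_simps)

lemma lap_sum: "lap (\<lambda>x. \<Sum>i\<in>I. c * f i x) x = c * (\<Sum>i\<in>I. lap (f i) x)"
  by (simp add: lap_eq sum_distrib_left sum_subtractf[symmetric] right_diff_distrib) (rule sum.swap)

section \<open>Finitely supported functions on the vertices and self-adjointness of the
  Laplacian\<close>

definition finsupp :: "('v \<Rightarrow> real) \<Rightarrow> bool" where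
  "finsupp f \<longleftrightarrow> finite {x. f x \<noteq> 0} \<and> {x. f x \<noteq> 0} \<subseteq> verts Y"

text \<open>\<open>Sum_any\<close> sums over the support of the product, so no index set has to be
  carried along; its value is 0 if that support is infinite.\<close>

definition dot :: "('v \<Rightarrow> real) \<Rightarrow> ('v \<Rightarrow> real) \<Rightarrow> real" where
  "dot f g = Sum_any (\<lambda>x. f x * g x)"

lemma dot_eq:
  assumes "finite X" "\<And>x. x \<notin> X \<Longrightarrow> f x * g x = 0"
  shows "dot f g = (\<Sum>x\<in>X. f x * g x)"
  unfolding dot_def using assms by (intro Sum_any.expand_superset) auto

lemma dot_commute: "dot f g = dot g f"
  by (simp add: dot_def mult.commute)

lemma dot_indicator: "dot (indicator {x}) f = f x"
  by (subst dot_eq[of "{x}"]) auto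

lemma finsupp_indicator: "x \<in> verts Y \<Longrightarrow> finsupp (indicator {x})"
  by (auto simp: finsupp_def indicator_def)

lemma finsupp_lin: "finsupp f \<Longrightarrow> finsupp g \<Longrightarrow> finsupp (\<lambda>x. a * f x + b * g x)"
proof -
  assume "finsupp f" "finsupp g"
  moreover have "{x. a * f x + b * g x \<noteq> 0} \<subseteq> {x. f x \<noteq> 0} \<union> {x. g x \<noteq> 0}" by auto
  ultimately show ?thesis
    unfolding finsupp_def by (meson Un_least finite_UnI finite_subset subset_trans)
qed

lemma finsupp_lap:
  assumes "finsupp f"
  shows "finsupp (lap f)"
proof -
  let ?N = "\<Union>x\<in>{x. f x \<noteq> 0}. insert x ((\<lambda>e. other e x) ` inc x)"
  have "x \<in> ?N" if "lap f x \<noteq> 0" for x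
  proof -
    have "\<exists>e\<in>inc x. f x - f (other e x) \<noteq> 0"
      using that unfolding lap_eq by (meson sum.neutral)
    then obtain e where e: "e \<in> inc x" "f x \<noteq> f (other e x)" by auto
    then consider "f x \<noteq> 0" | "f (other e x) \<noteq> 0" by fastforce
    then show ?thesis
    proof cases
      case 2
      have "other e (other e x) = x" using e by (auto simp: other_def mem_inc)
      then show ?thesis using 2 other_in_inc[OF e(1)] by force
    qed auto
  qed
  then have "{x. lap f x \<noteq> 0} \<subseteq> ?N" by blast
  moreover have "finite ?N" using assms by (auto simp: finsupp_def)
  moreover have "?N \<subseteq> verts Y" using assms other_in_verts by (auto simp: finsupp_def)
  ultimately show ?thesis unfolding finsupp_def by (meson finite_subset subset_trans)
qed

text \<open>Both sides equal the Dirichlet form, the sum of \<open>grad f e * grad g e\<close>, by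
  \<open>green\<close> applied once to each function.\<close>

lemma dot_lap:
  assumes "finsupp f" "finsupp g"
  shows "dot f (lap g) = dot (lap f) g"
proof -
  let ?X = "{x. f x \<noteq> 0} \<union> {x. g x \<noteq> 0}"
  let ?F = "\<Union>x\<in>?X. inc x"
  have X: "finite ?X" using assms by (auto simp: finsupp_def)
  have F: "finite ?F" "?F \<subseteq> edges Y" using X inc_subset by auto
  have "dot f (lap g) = (\<Sum>x\<in>?X. f x * bd (grad g) x)"
    using X by (subst dot_eq[of ?X]) (auto simp: lap_def)
  also have "\<dots> = (\<Sum>e\<in>?F. grad f e * grad g e)"
    using X F by (intro green[symmetric]) auto
  also have "\<dots> = (\<Sum>e\<in>?F. grad g e * grad f e)" by (simp add: mult.commute)
  also have "\<dots> = (\<Sum>x\<in>?X. g x * bd (grad f) x)"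
    using X F by (intro green) auto
  also have "\<dots> = dot g (lap f)"
    using X by (subst dot_eq[of ?X]) (auto simp: lap_def)
  finally show ?thesis by (simp add: dot_commute)
qed

end

section \<open>The lazy random walk\<close>

locale regular_graph = oriented_graph Y src tgt
  for Y :: "('v, 'e) graph" and src tgt :: "'e \<Rightarrow> 'v" +
  fixes D :: real
  assumes D_pos: "D > 0" and regular: "x \<in> verts Y \<Longrightarrow> real (card (inc x)) = D"
begin

text \<open>The transition operator of the lazy simple random walk.\<close>

definition lazy :: "('v \<Rightarrow> real) \<Rightarrow> 'v \<Rightarrow> real" where
  "lazy f x = f x - lap f x / (2 * D)"

abbreviation "walk n \<equiv> lazy ^^ n"

text \<open>The Green kernel truncated at time \<open>N\<close>. Since
  \<open>lap = 2 * D * (1 - lazy)\<close>, the factor \<open>1 / (2 * D)\<close> makes its Laplacian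
  telescope to \<open>f - walk N f\<close> in \<open>lap_green_op\<close>.\<close>

definition green_op :: "nat \<Rightarrow> ('v \<Rightarrow> real) \<Rightarrow> 'v \<Rightarrow> real" where
  "green_op N f x = (\<Sum>n<N. (1 / (2 * D)) * walk n f x)"

lemma lazy_lin: "lazy (\<lambda>x. a * f x + b * g x) = (\<lambda>x. a * lazy f x + b * lazy g x)"
  using D_pos by (auto simp: lazy_def lap_lin field_simps)

lemma walk_lin: "walk n (\<lambda>x. a * f x + b * g x) = (\<lambda>x. a * walk n f x + b * walk n g x)"
  by (induction n) (simp_all add: lazy_lin)

lemma walk_sum:
  assumes "finite I"
  shows "walk n (\<lambda>x. \<Sum>i\<in>I. f i x) = (\<lambda>x. \<Sum>i\<in>I. walk n (f i) x)"
  using assms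
proof induction
  case empty
  show ?case using walk_lin[of n 0 "\<lambda>_. 0" 0 "\<lambda>_. 0"] by simp
next
  case (insert i I)
  then show ?case using walk_lin[of n 1 "f i" 1 "\<lambda>x. \<Sum>i\<in>I. f i x"] by simp
qed

lemma finsupp_lazy: "finsupp f \<Longrightarrow> finsupp (lazy f)"
  using finsupp_lin[of f "lap f" 1 "- 1 / (2 * D)"] finsupp_lap[of f]
  by (simp add: lazy_def[abs_def])

lemma finsupp_walk: "finsupp f \<Longrightarrow> finsupp (walk n f)"
  by (induction n) (auto intro: finsupp_lazy)

lemma dot_lin_right:
  assumes "finsupp f"
  shows "dot f (\<lambda>x. a * g x + b * h x) = a * dot f g + b * dot f h"
proof -
  have *: "dot f h = (\<Sum>x | f x \<noteq> 0. f x * h x)" for h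
    using assms by (intro dot_eq) (auto simp: finsupp_def)
  show ?thesis
    unfolding * sum_distrib_left sum.distrib[symmetric]
    by (intro sum.cong) (auto simp: algebra_simps)
qed

lemma dot_lazy:
  assumes "finsupp f" "finsupp g"
  shows "dot f (lazy g) = dot (lazy f) g"
proof -
  have "lazy h = (\<lambda>x. 1 * h x + (- 1 / (2 * D)) * lap h x)" for h
    by (auto simp: lazy_def)
  then show ?thesis
    using assms by (simp only: dot_lin_right dot_commute[of _ g] dot_lap)
qed

lemma dot_walk:
  assumes "finsupp f" "finsupp g"
  shows "dot f (walk n g) = dot (walk n f) g"
  using assms
proof (induction n arbitrary: f)
  case (Suc n)
  have "dot f (walk (Suc n) g) = dot (lazy f) (walk n g)"
    using Suc.prems by (simp add: dot_lazy finsupp_walk)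
  also have "\<dots> = dot (walk n (lazy f)) g"
    by (intro Suc finsupp_lazy)
  finally show ?case by (simp add: funpow_swap1)
qed simp

lemma walk_sym:
  assumes "x \<in> verts Y" "y \<in> verts Y"
  shows "walk n (indicator {x}) y = walk n (indicator {y}) x"
  using dot_walk[OF assms[THEN finsupp_indicator], of n] dot_indicator
  by (simp add: dot_commute[of _ "indicator {y}"])

lemma lap_green_op: "lap (green_op N f) x = f x - walk N f x"
proof -
  have "lap (green_op N f) x = 1 / (2 * D) * (\<Sum>n<N. lap (walk n f) x)"
    unfolding green_op_def[abs_def] by (rule lap_sum)
  also have "\<dots> = (\<Sum>n<N. walk n f x - walk (Suc n) f x)"
    by (simp add: sum_distrib_left lazy_def)
  also have "\<dots> = f x - walk N f x"
    by (subst sum_lessThan_telescope'[of "\<lambda>n. walk n f x"]) simp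
  finally show ?thesis .
qed

lemma finsupp_green_op: "finsupp f \<Longrightarrow> finsupp (green_op N f)"
proof (induction N)
  case (Suc N)
  have "green_op (Suc N) f = (\<lambda>x. 1 * green_op N f x + 1 / (2 * D) * walk N f x)"
    by (auto simp: green_op_def)
  then show ?case using Suc finsupp_lin[OF Suc.IH finsupp_walk] by metis
qed (simp add: green_op_def[abs_def] finsupp_def)

text \<open>In \<open>distance_to_gradient\<close> this merges the two terms
  \<open>green_op N\<close> and \<open>walk N\<close> of \<open>green_op N\<close> into one kernel
  truncated at \<open>N + N\<close>.\<close>

lemma green_op_add: "green_op (M + N) f x = green_op M f x + walk M (green_op N f) x"
proof -
  have "walk M (green_op N f) = (\<lambda>x. \<Sum>n<N. walk M (\<lambda>x. 1 / (2 * D) * walk n f x) x)"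
    unfolding green_op_def[abs_def] by (rule walk_sum) simp
  moreover have "walk M (\<lambda>x. 1 / (2 * D) * walk n f x) = (\<lambda>x. 1 / (2 * D) * walk (M + n) f x)" for n
    using walk_lin[of M "1 / (2 * D)" "walk n f" 0 "\<lambda>_. 0"] by (simp add: funpow_add)
  moreover have "(\<Sum>n<M + N. g n) = (\<Sum>n<M. g n) + (\<Sum>n<N. g (M + n))" for g :: "nat \<Rightarrow> real"
    by (induction N) auto
  ultimately show ?thesis by (simp add: green_op_def)
qed

lemma green_op_lin: "green_op N (\<lambda>x. a * f x + b * g x) x = a * green_op N f x + b * green_op N g x"
  by (simp add: green_op_def walk_lin sum_distrib_left sum.distrib[symmetric] algebra_simps add_divide_distrib)

text \<open>The charge is zero for a loop. The coefficients 1 and -1 are written out to match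
  \<open>finsupp_lin\<close> and \<open>green_op_lin\<close>.\<close>

definition dipole :: "'e \<Rightarrow> 'v \<Rightarrow> real" where
  "dipole e = (\<lambda>x. 1 * indicator {tgt e} x + (- 1) * indicator {src e} x)"

text \<open>For recurrent and transient graphs alike, \<open>resistance N e\<close> increases with \<open>N\<close> to the
  wired effective resistance between the ends of \<open>e\<close>.\<close>

definition resistance :: "nat \<Rightarrow> 'e \<Rightarrow> real" where
  "resistance N e = grad (green_op N (dipole e)) e"

text \<open>The cross terms combine because
  \<open>\<parallel>grad k\<parallel>\<^sup>2 = \<langle>k, lap k\<rangle> = \<langle>k, dipole e - walk N (dipole e)\<rangle>\<close> for \<open>k = green_op N (dipole e)\<close>.\<close>

lemma distance_to_gradient:
  assumes e: "e \<in> edges Y" and F: "finite F" "F \<subseteq> edges Y" "e \<in> F"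
    and FX: "\<And>x. green_op N (dipole e) x \<noteq> 0 \<Longrightarrow> inc x \<subseteq> F"
  shows "(\<Sum>d\<in>F. (indicator {e} d - grad (green_op N (dipole e)) d)\<^sup>2) = 1 - resistance (N + N) e"
proof -
  define f k where "f = dipole e" and "k = green_op N f"
  let ?X = "{x. k x \<noteq> 0}"
  have fs: "finsupp f" unfolding f_def dipole_def
    by (intro finsupp_lin finsupp_indicator src_in_verts tgt_in_verts e)
  then have ks: "finsupp k" by (simp add: k_def finsupp_green_op)
  then have X: "finite ?X" by (simp add: finsupp_def)
  have dotf: "dot f h = grad h e" for h
  proof -
    have "dot f h = (\<Sum>x\<in>{tgt e, src e}. f x * h x)" by (rule dot_eq) (auto simp: f_def dipole_def)
    then show ?thesis by (cases "tgt e = src e") (auto simp: f_def dipole_def grad_def)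
  qed
  have "(\<Sum>d\<in>F. grad k d * grad k d) = (\<Sum>x\<in>?X. k x * lap k x)"
    unfolding lap_def using X F FX by (intro green) (auto simp: k_def f_def)
  also have "\<dots> = dot k (lap k)" using X by (subst dot_eq[of ?X]) auto
  also have "lap k = (\<lambda>x. 1 * f x + (- 1) * walk N f x)"
    by (auto simp: k_def lap_green_op)
  also have "dot k \<dots> = dot f k - dot f (walk N k)"
    using dot_walk[OF ks fs, of N] ks by (simp only: dot_lin_right) (simp add: dot_commute[of _ f])
  finally have kk: "(\<Sum>d\<in>F. grad k d * grad k d) = grad k e - grad (walk N k) e"
    by (simp add: dotf)
  have "(\<Sum>d\<in>F. (indicator {e} d - grad k d)\<^sup>2) =
      (\<Sum>d\<in>F. (if d = e then 1 - 2 * grad k d else 0) + grad k d * grad k d)"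
    by (intro sum.cong) (auto simp: power2_eq_square algebra_simps)
  also have "\<dots> = 1 - grad k e - grad (walk N k) e"
    using F kk by (simp add: sum.distrib)
  finally show ?thesis by (simp add: k_def f_def resistance_def grad_def green_op_add)
qed

end

section \<open>Harmonic cycles and automorphisms\<close>

context oriented_graph
begin

text \<open>An automorphism need not respect the chosen orientation; the value is -1 on the edges
  that it reverses. With this sign, \<open>pull\<close> commutes with the boundary
  (\<open>bd_pull\<close>).\<close>

definition sign :: "('v \<Rightarrow> 'v) \<Rightarrow> ('e \<Rightarrow> 'e) \<Rightarrow> 'e \<Rightarrow> real" where
  "sign \<phi> \<psi> e = (if src (\<psi> e) = \<phi> (src e) then 1 else - 1)"

definition pull :: "('v \<Rightarrow> 'v) \<Rightarrow> ('e \<Rightarrow> 'e) \<Rightarrow> ('e \<Rightarrow> real) \<Rightarrow> 'e \<Rightarrow> real" where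
  "pull \<phi> \<psi> h e = (if e \<in> edges Y then sign \<phi> \<psi> e * h (\<psi> e) else 0)"

lemma sign_square [simp]: "sign \<phi> \<psi> e * sign \<phi> \<psi> e = 1" "sign \<phi> \<psi> e * (sign \<phi> \<psi> e * t) = t"
  by (simp_all add: sign_def)

lemma automorphism_ends:
  assumes "graph_automorphism Y \<phi> \<psi>" "e \<in> edges Y"
  shows "\<psi> e \<in> edges Y"
    and "src (\<psi> e) = \<phi> (src e) \<and> tgt (\<psi> e) = \<phi> (tgt e) \<or>
         src (\<psi> e) = \<phi> (tgt e) \<and> tgt (\<psi> e) = \<phi> (src e)"
proof -
  show *: "\<psi> e \<in> edges Y"
    using assms by (auto simp: graph_automorphism_def bij_betw_def)
  have "ends Y (\<psi> e) = \<phi> ` ends Y e" using assms by (simp add: graph_automorphism_def)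
  then have "{src (\<psi> e), tgt (\<psi> e)} = {\<phi> (src e), \<phi> (tgt e)}"
    using ends_eq[OF *] ends_eq[OF assms(2)] by simp
  then show "src (\<psi> e) = \<phi> (src e) \<and> tgt (\<psi> e) = \<phi> (tgt e) \<or>
         src (\<psi> e) = \<phi> (tgt e) \<and> tgt (\<psi> e) = \<phi> (src e)"
    by (auto simp: doubleton_eq_iff)
qed

lemma automorphism_inj:
  assumes "graph_automorphism Y \<phi> \<psi>" "x \<in> verts Y" "y \<in> verts Y"
  shows "\<phi> x = \<phi> y \<longleftrightarrow> x = y"
  using assms by (auto simp: graph_automorphism_def bij_betw_def inj_on_def)

lemma automorphism_inc:
  assumes aut: "graph_automorphism Y \<phi> \<psi>" and x: "x \<in> verts Y"
  shows "bij_betw \<psi> (inc x) (inc (\<phi> x))"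
proof -
  have b: "inj_on \<psi> (edges Y)" "\<psi> ` edges Y = edges Y"
    using aut by (auto simp: graph_automorphism_def bij_betw_def)
  have iff: "\<psi> e \<in> inc (\<phi> x) \<longleftrightarrow> e \<in> inc x" if "e \<in> edges Y" for e
    using automorphism_ends[OF aut that] that automorphism_inj[OF aut _ x]
      src_in_verts[OF that] tgt_in_verts[OF that]
    unfolding mem_inc by metis
  have "\<psi> ` inc x = inc (\<phi> x)"
  proof (intro equalityI subsetI)
    fix d assume d: "d \<in> inc (\<phi> x)"
    then obtain e where "e \<in> edges Y" "d = \<psi> e" using b inc_subset by blast
    then show "d \<in> \<psi> ` inc x" using d iff by blast
  qed (use iff inc_subset in blast)
  then show ?thesis
    using inj_on_subset[OF b(1) inc_subset] by (simp add: bij_betw_def)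
qed

lemma bd_pull:
  assumes aut: "graph_automorphism Y \<phi> \<psi>" and x: "x \<in> verts Y"
  shows "bd (pull \<phi> \<psi> h) x = bd h (\<phi> x)"
proof -
  have "bd h (\<phi> x) = (\<Sum>e\<in>inc (\<phi> x).
      (if tgt e = \<phi> x then h e else 0) - (if src e = \<phi> x then h e else 0))"
    by (rule bd_eq) (auto simp: inc_subset)
  also have "\<dots> = (\<Sum>e\<in>inc x.
      (if tgt (\<psi> e) = \<phi> x then h (\<psi> e) else 0) - (if src (\<psi> e) = \<phi> x then h (\<psi> e) else 0))"
    by (rule sum.reindex_bij_betw[symmetric, OF automorphism_inc[OF aut x]])
  also have "\<dots> = (\<Sum>e\<in>inc x.
      (if tgt e = x then pull \<phi> \<psi> h e else 0) - (if src e = x then pull \<phi> \<psi> h e else 0))"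
  proof (rule sum.cong[OF refl])
    fix e assume "e \<in> inc x"
    then have e: "e \<in> edges Y" by (simp add: mem_inc)
    note v = src_in_verts[OF e] tgt_in_verts[OF e]
    have i: "\<phi> (src e) = \<phi> x \<longleftrightarrow> src e = x" "\<phi> (tgt e) = \<phi> x \<longleftrightarrow> tgt e = x"
      "\<phi> x = \<phi> (src e) \<longleftrightarrow> src e = x" "\<phi> x = \<phi> (tgt e) \<longleftrightarrow> tgt e = x"
      "\<phi> (tgt e) = \<phi> (src e) \<longleftrightarrow> tgt e = src e"
      using v x automorphism_inj[OF aut] by blast+
    from automorphism_ends(2)[OF aut e]
    show "(if tgt (\<psi> e) = \<phi> x then h (\<psi> e) else 0) - (if src (\<psi> e) = \<phi> x then h (\<psi> e) else 0) =
       (if tgt e = x then pull \<phi> \<psi> h e else 0) - (if src e = x then pull \<phi> \<psi> h e else 0)"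
      by (elim disjE conjE) (simp_all add: pull_def sign_def e i)
  qed
  also have "\<dots> = bd (pull \<phi> \<psi> h) x"
    by (rule bd_eq[symmetric]) (auto simp: inc_subset)
  finally show ?thesis by simp
qed

text \<open>On the edges \<open>grad f\<close> is the pullback of \<open>grad g\<close>, so
  \<open>bd_pull\<close> applies.\<close>

lemma lap_automorphism:
  assumes aut: "graph_automorphism Y \<phi> \<psi>" and x: "x \<in> verts Y"
    and fg: "\<And>y. y \<in> verts Y \<Longrightarrow> f y = g (\<phi> y)"
  shows "lap f x = lap g (\<phi> x)"
proof -
  have "grad f e = pull \<phi> \<psi> (grad g) e" if e: "e \<in> edges Y" for e
  proof -
    have i: "\<phi> (tgt e) = \<phi> (src e) \<longleftrightarrow> tgt e = src e"
      using src_in_verts[OF e] tgt_in_verts[OF e] automorphism_inj[OF aut] by blast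
    show ?thesis
      using automorphism_ends(2)[OF aut e] fg src_in_verts[OF e] tgt_in_verts[OF e]
      by (elim disjE conjE) (simp_all add: pull_def sign_def e i grad_def)
  qed
  then have "bd (grad f) x = bd (pull \<phi> \<psi> (grad g)) x"
    unfolding chain_boundary_def by (auto intro!: arg_cong2[where f = "(-)"] sum.cong)
  then show ?thesis by (simp add: lap_def bd_pull[OF aut x])
qed

lemma pull_l2:
  assumes aut: "graph_automorphism Y \<phi> \<psi>" and h: "h \<in> l2_chains Y"
  shows "pull \<phi> \<psi> h \<in> l2_chains Y"
proof -
  have "bij_betw \<psi> (edges Y) (edges Y)" using aut by (simp add: graph_automorphism_def)
  then have "(\<lambda>e. (h (\<psi> e))\<^sup>2) summable_on edges Y"
    using h summable_on_reindex_bij_betw[of \<psi> "edges Y" "edges Y" "\<lambda>e. (h e)\<^sup>2"]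
    by (simp add: l2_chains_def)
  moreover have "(\<lambda>e. (pull \<phi> \<psi> h e)\<^sup>2) summable_on edges Y
      \<longleftrightarrow> (\<lambda>e. (h (\<psi> e))\<^sup>2) summable_on edges Y"
    by (intro summable_on_cong) (simp add: pull_def sign_def)
  ultimately show ?thesis by (simp add: l2_chains_def pull_def)
qed

lemma l2_inner_pull:
  assumes aut: "graph_automorphism Y \<phi> \<psi>"
  shows "l2_inner Y (pull \<phi> \<psi> f) (pull \<phi> \<psi> g) = l2_inner Y f g"
proof -
  have b: "bij_betw \<psi> (edges Y) (edges Y)" using aut by (simp add: graph_automorphism_def)
  have "l2_inner Y (pull \<phi> \<psi> f) (pull \<phi> \<psi> g) = (\<Sum>\<^sub>\<infinity>e\<in>edges Y. f (\<psi> e) * g (\<psi> e))"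
    unfolding l2_inner_def by (intro infsum_cong) (simp add: pull_def mult_ac)
  also have "\<dots> = l2_inner Y f g"
    unfolding l2_inner_def by (rule infsum_reindex_bij_betw[OF b])
  finally show ?thesis .
qed

text \<open>Pullbacks preserve inner products. To see that the pullback of a harmonic cycle is
  orthogonal to all finite cycles, each finite cycle must therefore itself be a pullback of
  one.\<close>

lemma finite_cycle_pull_preimage:
  assumes aut: "graph_automorphism Y \<phi> \<psi>" and g: "g \<in> finite_cycles Y src tgt"
  obtains g' where "g' \<in> finite_cycles Y src tgt" "pull \<phi> \<psi> g' = g"
proof -
  have b: "inj_on \<psi> (edges Y)" "\<psi> ` edges Y = edges Y" "\<phi> ` verts Y = verts Y"
    using aut by (auto simp: graph_automorphism_def bij_betw_def)
  have g0: "g e = 0" if "e \<notin> edges Y" for e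
    using g that by (simp add: finite_cycles_def l2_cycles_def l2_chains_def)
  define i where "i = inv_into (edges Y) \<psi>"
  \<comment> \<open>The sign squares to 1, so the sign at the preimage edge undoes the one in
    \<open>pull\<close>.\<close>
  define g' where "g' d = (if d \<in> edges Y then sign \<phi> \<psi> (i d) * g (i d) else 0)" for d
  have i: "i (\<psi> e) = e" "\<psi> e \<in> edges Y" if "e \<in> edges Y" for e
    using b that by (auto simp: i_def)
  have pull: "pull \<phi> \<psi> g' = g"
    by (rule ext) (auto simp: pull_def g'_def i g0)
  have "{d. g' d \<noteq> 0} \<subseteq> \<psi> ` {e. g e \<noteq> 0}"
  proof
    fix d assume "d \<in> {d. g' d \<noteq> 0}"
    then have "d \<in> edges Y" "g (i d) \<noteq> 0" by (auto simp: g'_def split: if_splits)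
    then show "d \<in> \<psi> ` {e. g e \<noteq> 0}" using b i by (metis (mono_tags) imageE imageI mem_Collect_eq)
  qed
  then have fin: "finite {d. g' d \<noteq> 0}"
    using g finite_subset by (auto simp: finite_cycles_def)
  then have l2: "g' \<in> l2_chains Y" by (rule finite_support_l2) (simp add: g'_def)
  have "bd g' y = 0" if "y \<in> verts Y" for y
  proof -
    have "y \<in> \<phi> ` verts Y" using that b(3) by simp
    then obtain x where "x \<in> verts Y" "y = \<phi> x" by (elim imageE)
    then show ?thesis
      using bd_pull[OF aut, of x g'] pull g by (simp add: finite_cycles_def l2_cycles_def)
  qed
  then have "g' \<in> finite_cycles Y src tgt"
    using fin l2 by (simp add: finite_cycles_def l2_cycles_def)
  then show thesis using pull by (rule that)
qed

abbreviation "harmonics \<equiv> harmonic_cycles Y src tgt"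

lemma pull_harmonic:
  assumes aut: "graph_automorphism Y \<phi> \<psi>" and h: "h \<in> harmonics"
  shows "pull \<phi> \<psi> h \<in> harmonics"
proof -
  have v: "\<phi> x \<in> verts Y" if "x \<in> verts Y" for x
    using aut that by (auto simp: graph_automorphism_def bij_betw_def)
  have "l2_inner Y (pull \<phi> \<psi> h) g = 0" if g: "g \<in> finite_cycles Y src tgt" for g
  proof -
    obtain g' where g': "g' \<in> finite_cycles Y src tgt" "pull \<phi> \<psi> g' = g"
      using finite_cycle_pull_preimage[OF aut g] .
    then have "l2_inner Y (pull \<phi> \<psi> h) g = l2_inner Y h g'"
      using l2_inner_pull[OF aut] by blast
    then show ?thesis using g' h by (simp add: harmonic_cycles_def)
  qed
  then show ?thesis
    using h v pull_l2[OF aut] bd_pull[OF aut] by (simp add: harmonic_cycles_def l2_cycles_def)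
qed

section \<open>The harmonic cycles form a closed subspace\<close>

lemma bd_lin: "bd (\<lambda>e. a * f e + b * g e) x = a * bd f x + b * bd g x"
  unfolding chain_boundary_def sum.distrib sum_distrib_left[symmetric]
  by (simp add: algebra_simps)

lemma harm_l2: "harmonics \<subseteq> l2_chains Y"
  by (auto simp: harmonic_cycles_def l2_cycles_def)

lemma finite_cycles_l2: "finite_cycles Y src tgt \<subseteq> l2_chains Y"
  by (auto simp: finite_cycles_def l2_cycles_def)

lemma harm_nonempty: "harmonics \<noteq> {}"
proof -
  have "(\<lambda>_. 0) \<in> harmonics"
    by (simp add: harmonic_cycles_def l2_cycles_def l2_chains_def chain_boundary_def l2_inner_def)
  then show ?thesis by blast
qed

lemma harm_lin:
  assumes "f \<in> harmonics" "g \<in> harmonics"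
  shows "(\<lambda>e. a * f e + b * g e) \<in> harmonics"
proof -
  have l2: "f \<in> l2_chains Y" "g \<in> l2_chains Y" using assms harm_l2 by blast+
  have "l2_inner Y (\<lambda>e. a * f e + b * g e) c = 0" if c: "c \<in> finite_cycles Y src tgt" for c
  proof -
    have "c \<in> l2_chains Y" using c finite_cycles_l2 by blast
    with assms c show ?thesis
      by (simp add: l2_inner_lincomb_left[OF l2] harmonic_cycles_def)
  qed
  then show ?thesis
    using assms by (simp add: harmonic_cycles_def l2_cycles_def l2_chains_lincomb bd_lin)
qed

text \<open>A boundary at a vertex and an inner product with a finitely supported cycle are finite
  sums, hence continuous under edgewise limits.\<close>

lemma harm_closed:
  assumes s: "\<And>n. s n \<in> harmonics" and lim: "\<And>e. (\<lambda>n. s n e) \<longlonglongrightarrow> g e" and g: "g \<in> l2_chains Y"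
  shows "g \<in> harmonics"
proof -
  have "bd g x = 0" if "x \<in> verts Y" for x
  proof (rule LIMSEQ_unique)
    show "(\<lambda>n. bd (s n) x) \<longlonglongrightarrow> bd g x"
      unfolding chain_boundary_def by (intro tendsto_intros lim)
    show "(\<lambda>n. bd (s n) x) \<longlonglongrightarrow> 0"
      using s that by (simp add: harmonic_cycles_def l2_cycles_def)
  qed
  moreover have "l2_inner Y g c = 0" if c: "c \<in> finite_cycles Y src tgt" for c
  proof (rule LIMSEQ_unique)
    have "finite {e. c e \<noteq> 0}" "{e. c e \<noteq> 0} \<subseteq> edges Y"
      using c by (auto simp: finite_cycles_def l2_cycles_def l2_chains_def)
    then have *: "l2_inner Y h c = (\<Sum>e | c e \<noteq> 0. h e * c e)" for h
      by (intro l2_inner_finite_support) auto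
    show "(\<lambda>n. l2_inner Y (s n) c) \<longlonglongrightarrow> l2_inner Y g c"
      unfolding * by (intro tendsto_intros lim)
    show "(\<lambda>n. l2_inner Y (s n) c) \<longlonglongrightarrow> 0"
      using s c by (simp add: harmonic_cycles_def)
  qed
  ultimately show ?thesis using g by (simp add: harmonic_cycles_def l2_cycles_def)
qed

section \<open>The diagonal of the harmonic projection\<close>

definition harm_proj :: "'e \<Rightarrow> 'e \<Rightarrow> real" where
  "harm_proj e = l2_proj Y harmonics (indicator {e})"

definition weight :: "'e \<Rightarrow> real" where
  "weight e = harm_proj e e"

text \<open>The projected edge is the reproducing kernel of the harmonic cycles: it represents
  evaluation at \<open>e\<close>. Pairing it with itself gives
  \<open>harm_proj_norm\<close>.\<close>

lemma harm_proj:
  assumes e: "e \<in> edges Y"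
  shows "harm_proj e \<in> harmonics" and "g \<in> harmonics \<Longrightarrow> l2_inner Y (harm_proj e) g = g e"
proof -
  have *: "harm_proj e \<in> harmonics \<and> (\<forall>g\<in>harmonics. l2_inner Y (\<lambda>d. indicator {e} d - harm_proj e d) g = 0)"
    unfolding harm_proj_def
    by (rule l2_proj_spec[OF indicator_l2[OF e] harm_l2 harm_nonempty])
      (rule harm_lin harm_closed; assumption)+
  then show "harm_proj e \<in> harmonics" by blast
  assume g: "g \<in> harmonics"
  have l2: "harm_proj e \<in> l2_chains Y" "g \<in> l2_chains Y" using * g harm_l2 by blast+
  have "0 = l2_inner Y (\<lambda>d. 1 * indicator {e} d + (- 1) * harm_proj e d) g" using * g by simp
  also have "\<dots> = l2_inner Y (indicator {e}) g - l2_inner Y (harm_proj e) g"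
    using l2 indicator_l2[OF e] by (simp only: l2_inner_lincomb_left)
  also have "l2_inner Y (indicator {e}) g = g e"
    using l2_inner_indicator[OF e, of g] by (simp add: l2_inner_commute)
  finally show "l2_inner Y (harm_proj e) g = g e" by simp
qed

lemma l2_betti1_eq: "l2_betti1 Y src tgt x = 1 / 2 * (\<Sum>e\<in>inc x. weight e)"
proof -
  have "l2_inner Y (harm_proj e) (indicator {e}) = weight e" if "e \<in> inc x" for e
    using that by (simp add: weight_def l2_inner_indicator mem_inc)
  then show ?thesis by (simp add: l2_betti1_def harm_proj_def)
qed

lemma harm_proj_norm: "e \<in> edges Y \<Longrightarrow> l2_inner Y (harm_proj e) (harm_proj e) = weight e"
  by (simp add: harm_proj weight_def)

text \<open>The pullback \<open>?q\<close> is harmonic, has squared norm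
  \<open>weight (\<psi> e)\<close> and takes the value \<open>weight (\<psi> e)\<close> at
  \<open>e\<close> up to sign. The squared distance from \<open>?p\<close> to the signed
  \<open>?q\<close> is thus \<open>weight e - weight (\<psi> e)\<close>, which is
  nonnegative.\<close>

lemma weight_automorphism_le:
  assumes aut: "graph_automorphism Y \<phi> \<psi>" and e: "e \<in> edges Y"
  shows "weight (\<psi> e) \<le> weight e"
proof -
  have e': "\<psi> e \<in> edges Y" by (rule automorphism_ends(1)[OF aut e])
  let ?p = "harm_proj e" and ?q = "pull \<phi> \<psi> (harm_proj (\<psi> e))"
  have q: "?q \<in> harmonics" by (rule pull_harmonic[OF aut harm_proj(1)[OF e']])
  have l2: "?p \<in> l2_chains Y" "?q \<in> l2_chains Y" using q harm_proj(1)[OF e] harm_l2 by blast+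
  have s: "sign \<phi> \<psi> e * ?q e = weight (\<psi> e)" by (simp add: pull_def e weight_def)
  have "0 \<le> l2_inner Y (\<lambda>d. 1 * ?p d + (- sign \<phi> \<psi> e) * ?q d) (\<lambda>d. 1 * ?p d + (- sign \<phi> \<psi> e) * ?q d)"
    by (rule l2_inner_self_nonneg)
  also have "\<dots> = weight e - 2 * (sign \<phi> \<psi> e * ?q e) + weight (\<psi> e)"
    unfolding l2_norm_lincomb[OF l2]
    by (simp add: harm_proj_norm e e' l2_inner_pull[OF aut] harm_proj(2)[OF e q] power2_eq_square)
  finally show ?thesis unfolding s by simp
qed

lemma sum_weight_automorphism_le:
  assumes aut: "graph_automorphism Y \<phi> \<psi>" and x: "x \<in> verts Y"
  shows "(\<Sum>e\<in>inc (\<phi> x). weight e) \<le> (\<Sum>e\<in>inc x. weight e)"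
proof -
  have "(\<Sum>e\<in>inc (\<phi> x). weight e) = (\<Sum>e\<in>inc x. weight (\<psi> e))"
    by (rule sum.reindex_bij_betw[symmetric, OF automorphism_inc[OF aut x]])
  also have "\<dots> \<le> (\<Sum>e\<in>inc x. weight e)"
    by (intro sum_mono weight_automorphism_le[OF aut]) (simp add: mem_inc)
  finally show ?thesis .
qed

text \<open>By orthogonality \<open>weight e\<close> is the pairing of \<open>harm_proj e\<close>
  with \<open>indicator {e} - u\<close>. Twice this is at most the sum of the two squared norms, and
  that of \<open>harm_proj e\<close> is at most \<open>weight e\<close>.\<close>

lemma weight_le_distance:
  assumes F: "finite F" "F \<subseteq> edges Y" "e \<in> F"
    and orth: "(\<Sum>d\<in>F. harm_proj e d * u d) = 0"
  shows "weight e \<le> (\<Sum>d\<in>F. (indicator {e} d - u d)\<^sup>2)"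
proof -
  have e: "e \<in> edges Y" using F by blast
  have "weight e = (\<Sum>d\<in>F. if d = e then harm_proj e d else 0)"
    using F by (simp add: weight_def)
  also have "\<dots> = (\<Sum>d\<in>F. harm_proj e d * (indicator {e} d - u d))"
    unfolding right_diff_distrib sum_subtractf orth by (auto intro!: sum.cong)
  finally have 1: "2 * weight e = (\<Sum>d\<in>F. 2 * (harm_proj e d * (indicator {e} d - u d)))"
    by (simp add: sum_distrib_left[symmetric])
  also have "\<dots> \<le> (\<Sum>d\<in>F. (harm_proj e d)\<^sup>2 + (indicator {e} d - u d)\<^sup>2)"
    using sum_squares_bound by (intro sum_mono) (simp add: mult.assoc)
  also have "\<dots> \<le> weight e + (\<Sum>d\<in>F. (indicator {e} d - u d)\<^sup>2)"
    using sum_squares_le_l2_inner[of "harm_proj e" Y F] harm_proj(1)[OF e] harm_l2 F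
    by (auto simp: sum.distrib harm_proj_norm[OF e])
  finally show ?thesis by simp
qed

lemma finite_cycle_orth:
  assumes h: "h \<in> harmonics" and z: "z \<in> finite_cycles Y src tgt"
    and F: "finite F" "F \<subseteq> edges Y" "\<And>e. e \<notin> F \<Longrightarrow> z e = 0"
  shows "(\<Sum>e\<in>F. h e * z e) = 0"
proof -
  have "l2_inner Y h z = (\<Sum>e\<in>F. h e * z e)"
    using F by (intro l2_inner_finite_support) auto
  then show ?thesis using h z by (simp add: harmonic_cycles_def)
qed

text \<open>By \<open>green\<close> the sum pairs \<open>k\<close> with the boundary of
  \<open>h\<close>. It is applied in \<open>weight_le_cycle\<close> both to a harmonic cycle and to
  a finitely supported one.\<close>

lemma grad_orth:
  assumes h: "\<And>x. x \<in> verts Y \<Longrightarrow> bd h x = 0" and k: "finsupp k"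
    and F: "finite F" "F \<subseteq> edges Y" "\<And>x e. k x \<noteq> 0 \<Longrightarrow> e \<in> inc x \<Longrightarrow> e \<notin> F \<Longrightarrow> h e = 0"
  shows "(\<Sum>e\<in>F. grad k e * h e) = 0"
proof -
  have "(\<Sum>e\<in>F. grad k e * h e) = (\<Sum>x | k x \<noteq> 0. k x * bd h x)"
    using F k by (intro green) (auto simp: finsupp_def)
  also have "\<dots> = 0" using h k by (intro sum.neutral) (auto simp: finsupp_def)
  finally show ?thesis .
qed

text \<open>A loop is a finitely supported cycle, hence orthogonal to the harmonic ones. Loops can
  then be disregarded when edges are counted by their ends in
  \<open>sum_incident_eq\<close>.\<close>

lemma weight_loop:
  assumes e: "e \<in> edges Y" and "src e = tgt e"
  shows "weight e = 0"
proof -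
  have "bd (indicator {e}) x = 0" for x
    by (subst bd_eq[of "{e}"]) (use assms in auto)
  moreover have "finite {d. indicator {e} d \<noteq> (0 :: real)}"
    by (simp add: indicator_def)
  ultimately have "indicator {e} \<in> finite_cycles Y src tgt"
    by (simp add: finite_cycles_def l2_cycles_def indicator_l2[OF e])
  then have "l2_inner Y (harm_proj e) (indicator {e}) = 0"
    using harm_proj(1)[OF e] by (simp add: harmonic_cycles_def)
  then show ?thesis by (simp add: l2_inner_indicator[OF e] weight_def)
qed

text \<open>Here every harmonic cycle has finite support and so is orthogonal to itself. This
  settles the case in which return probabilities do not decay.\<close>

lemma weight_finite_graph:
  assumes "finite (verts Y)" and e: "e \<in> edges Y"
  shows "weight e = 0"
proof -
  have "edges Y \<subseteq> (\<Union>x\<in>verts Y. inc x)" using src_in_verts by (fastforce simp: mem_inc)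
  then have fin: "finite (edges Y)" using assms(1) finite_subset by fastforce
  have h: "harm_proj e \<in> harmonics" by (rule harm_proj(1)[OF e])
  then have "{d. harm_proj e d \<noteq> 0} \<subseteq> edges Y"
    by (auto simp: harmonic_cycles_def l2_cycles_def l2_chains_def)
  then have "harm_proj e \<in> finite_cycles Y src tgt"
    using h fin finite_subset by (auto simp: harmonic_cycles_def finite_cycles_def)
  then show ?thesis using h harm_proj_norm[OF e] by (simp add: harmonic_cycles_def)
qed

end

section \<open>Return probabilities\<close>

context regular_graph
begin

text \<open>A quantitative maximum principle: \<open>2 * D * (a - lazy f x)\<close> is a sum over
  the edges at \<open>x\<close> of nonnegative gaps \<open>(a - f x) + (a - f (other e x))\<close>,
  and one of these terms dominates \<open>a - f z\<close>.\<close>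

lemma lazy_gap:
  assumes fa: "\<And>y. y \<in> verts Y \<Longrightarrow> f y \<le> a" and x: "x \<in> verts Y"
    and z: "z = x \<or> (\<exists>e\<in>inc x. z = other e x)"
  shows "(a - f z) / (2 * D) \<le> a - lazy f x"
proof -
  let ?t = "\<lambda>e. (a - f x) + (a - f (other e x))"
  have "2 * D * (a - lazy f x) = D * (2 * (a - f x)) + lap f x"
    using D_pos by (simp add: lazy_def field_simps)
  also have "D * (2 * (a - f x)) = (\<Sum>e\<in>inc x. 2 * (a - f x))"
    using regular[OF x] by simp
  also have "\<dots> + lap f x = (\<Sum>e\<in>inc x. ?t e)"
    unfolding lap_eq sum.distrib[symmetric] by (intro sum.cong) auto
  finally have eq: "2 * D * (a - lazy f x) = (\<Sum>e\<in>inc x. ?t e)" .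
  have nonneg: "0 \<le> a - f x" "e \<in> inc x \<Longrightarrow> 0 \<le> a - f (other e x)" for e
    using fa x other_in_verts by simp_all
  obtain e where e: "e \<in> inc x" "a - f z \<le> ?t e"
  proof -
    have "inc x \<noteq> {}" using regular[OF x] D_pos by auto
    then show thesis using that z nonneg by fastforce
  qed
  have "?t e \<le> (\<Sum>e\<in>inc x. ?t e)"
    using e(1) by (intro member_le_sum add_nonneg_nonneg nonneg) auto
  then have "a - f z \<le> 2 * D * (a - lazy f x)" using e(2) eq by linarith
  then show ?thesis using D_pos by (simp add: field_simps)
qed

lemma lazy_le:
  assumes "\<And>y. y \<in> verts Y \<Longrightarrow> f y \<le> a" "x \<in> verts Y"
  shows "lazy f x \<le> a"
proof -
  have "0 \<le> (a - f x) / (2 * D)" using assms D_pos by simp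
  then show ?thesis using lazy_gap[of f a x x] assms by simp
qed

lemma walk_le:
  assumes "\<And>y. y \<in> verts Y \<Longrightarrow> f y \<le> a" "x \<in> verts Y"
  shows "walk n f x \<le> a"
  using assms(2) by (induction n arbitrary: x) (auto intro: assms(1) lazy_le)

section \<open>Invariance of the walk under automorphisms\<close>

lemma walk_automorphism:
  assumes aut: "graph_automorphism Y \<phi> \<psi>"
    and fg: "\<And>y. y \<in> verts Y \<Longrightarrow> f y = g (\<phi> y)" and x: "x \<in> verts Y"
  shows "walk n f x = walk n g (\<phi> x)"
  using x
proof (induction n arbitrary: x)
  case (Suc n)
  have "lap (walk n f) x = lap (walk n g) (\<phi> x)"
    by (rule lap_automorphism[OF aut Suc.prems]) (rule Suc.IH)
  then show ?case
    using Suc.IH[OF Suc.prems] by (simp add: lazy_def[of "walk n f"] lazy_def[of "walk n g"])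
qed (simp add: fg)

lemma walk_return_const:
  assumes "transitive_graph Y" "x \<in> verts Y" "y \<in> verts Y"
  shows "walk n (indicator {x}) x = walk n (indicator {y}) y"
proof -
  obtain \<phi> \<psi> where aut: "graph_automorphism Y \<phi> \<psi>" and y: "\<phi> x = y"
    using assms unfolding transitive_graph_def by blast
  have "indicator {x} v = (indicator {y} (\<phi> v) :: real)" if "v \<in> verts Y" for v
    using automorphism_inj[OF aut that assms(2)] y by (auto simp: indicator_def)
  then show ?thesis using walk_automorphism[OF aut] assms y by blast
qed

section \<open>Decay of the return probabilities\<close>

lemma dot_self_nonneg: "finsupp f \<Longrightarrow> 0 \<le> dot f f"
  by (subst dot_eq[of "{x. f x \<noteq> 0}"]) (auto simp: finsupp_def intro!: sum_nonneg)

lemma dot_AM_GM: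
  assumes "finsupp f" "finsupp g"
  shows "2 * dot f g \<le> dot f f + dot g g"
proof -
  let ?X = "{x. f x \<noteq> 0} \<union> {x. g x \<noteq> 0}"
  have X: "finite ?X" using assms by (simp add: finsupp_def)
  have "dot f g = (\<Sum>x\<in>?X. f x * g x)" "dot f f = (\<Sum>x\<in>?X. f x * f x)"
    "dot g g = (\<Sum>x\<in>?X. g x * g x)"
    by (rule dot_eq[OF X]; auto)+
  moreover have "2 * (\<Sum>x\<in>?X. f x * g x) \<le> (\<Sum>x\<in>?X. f x * f x + g x * g x)"
    unfolding sum_distrib_left
    using sum_squares_bound by (intro sum_mono) (simp add: power2_eq_square mult.assoc)
  ultimately show ?thesis by (simp add: sum.distrib)
qed

lemma walk_double:
  assumes x: "x \<in> verts Y" and y: "y \<in> verts Y"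
  shows "walk (n + n) (indicator {x}) y = dot (walk n (indicator {y})) (walk n (indicator {x}))"
  using dot_walk[of "indicator {y}" "walk n (indicator {x})" n] x y
  by (simp add: funpow_add dot_indicator finsupp_walk finsupp_indicator)

text \<open>At even times the kernel is an inner product of two half-time kernels. It is at most the
  mean of the return probabilities at \<open>x\<close> and \<open>y\<close>, which agree by
  transitivity.\<close>

lemma walk_double_le:
  assumes "transitive_graph Y" "x \<in> verts Y" "y \<in> verts Y"
  shows "walk (n + n) (indicator {x}) y \<le> walk (n + n) (indicator {x}) x"
  using dot_AM_GM[of "walk n (indicator {y})" "walk n (indicator {x})"]
    walk_return_const[OF assms, of "n + n"] assms
  by (simp add: walk_double finsupp_walk finsupp_indicator)

text \<open>The even return probabilities decrease to some \<open>c >= 0\<close>. As they are the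
  maximum of the kernel, \<open>lazy_gap\<close> carries the limit \<open>c\<close> along edges to
  every vertex; since the mass on any finite set is at most 1, \<open>c\<close> must be 0 on an
  infinite graph.\<close>

lemma return_probability_limit:
  assumes tr: "transitive_graph Y" and conn: "connected_graph Y" and inf: "infinite (verts Y)"
    and x: "x \<in> verts Y"
  shows "(\<lambda>n. walk (n + n) (indicator {x}) x) \<longlonglongrightarrow> 0"
proof -
  define b where "b n = walk (n + n) (indicator {x})" for n
  have ba: "b n y \<le> b n x" if "y \<in> verts Y" for n y
    unfolding b_def by (rule walk_double_le[OF tr x that])
  have b_Suc: "b (Suc n) = lazy (lazy (b n))" for n by (simp add: b_def)
  have "b (Suc n) x \<le> b n x" for n
    unfolding b_Suc using x by (intro lazy_le ba)
  then have "decseq (\<lambda>n. b n x)" by (rule decseq_SucI)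
  moreover have b0: "0 \<le> b n x" for n
    unfolding b_def walk_double[OF x x]
    by (intro dot_self_nonneg finsupp_walk finsupp_indicator x)
  ultimately obtain c where c: "(\<lambda>n. b n x) \<longlonglongrightarrow> c"
    using decseq_convergent by blast
  have c0: "0 \<le> c" using c b0 by (intro LIMSEQ_le_const) auto
  let ?R = "{(u, v). \<exists>e\<in>edges Y. ends Y e = {u, v}}"
  have lim: "(\<lambda>n. b n y) \<longlonglongrightarrow> c" if "(x, y) \<in> ?R\<^sup>*" for y
    using that
  proof induction
    case (step y z)
    then obtain e where e: "e \<in> edges Y" "ends Y e = {y, z}" by auto
    then have st: "{src e, tgt e} = {y, z}" using ends_eq by simp
    have ey: "e \<in> inc y" using e st by (auto simp: mem_inc doubleton_eq_iff)
    have z: "z = other e y" using st by (auto simp: other_def doubleton_eq_iff)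
    have v: "y \<in> verts Y" "z \<in> verts Y"
      using e(1) st src_in_verts tgt_in_verts by (auto simp: doubleton_eq_iff)
    \<comment> \<open>Passing from \<open>b n\<close> to \<open>b (Suc n)\<close> takes two lazy
      steps, each costing a factor \<open>2 * D\<close> in \<open>lazy_gap\<close>: one goes from
      \<open>y\<close> to its neighbour \<open>z\<close>, the other stays at
      \<open>y\<close>.\<close>
    have low: "b n x - (2 * D) * (2 * D) * (b n x - b (Suc n) y) \<le> b n z" for n
    proof -
      have "(b n x - b n z) / (2 * D) \<le> b n x - lazy (b n) y"
        using ey z v by (intro lazy_gap ba) auto
      then have 1: "b n x - b n z \<le> 2 * D * (b n x - lazy (b n) y)"
        using D_pos by (simp add: field_simps)
      have "(b n x - lazy (b n) y) / (2 * D) \<le> b n x - b (Suc n) y"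
        unfolding b_Suc using v by (intro lazy_gap lazy_le ba) auto
      then have "b n x - lazy (b n) y \<le> 2 * D * (b n x - b (Suc n) y)"
        using D_pos by (simp add: field_simps)
      then have "2 * D * (b n x - lazy (b n) y) \<le> 2 * D * (2 * D * (b n x - b (Suc n) y))"
        using D_pos by (intro mult_left_mono) auto
      with 1 show ?thesis by (simp add: mult.assoc)
    qed
    have "(\<lambda>n. b n x - (2 * D) * (2 * D) * (b n x - b (Suc n) y)) \<longlonglongrightarrow>
        c - (2 * D) * (2 * D) * (c - c)"
      by (intro tendsto_intros c LIMSEQ_Suc step.IH)
    then have "(\<lambda>n. b n x - (2 * D) * (2 * D) * (b n x - b (Suc n) y)) \<longlonglongrightarrow> c" (is "?l \<longlonglongrightarrow> c") by simp
    show ?case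
    proof (rule tendsto_sandwich[OF _ _ \<open>?l \<longlonglongrightarrow> c\<close> c])
      show "\<forall>\<^sub>F n in sequentially. b n x - (2 * D) * (2 * D) * (b n x - b (Suc n) y) \<le> b n z"
        by (rule always_eventually) (use low in blast)
      show "\<forall>\<^sub>F n in sequentially. b n z \<le> b n x"
        by (rule always_eventually) (use ba[OF v(2)] in blast)
    qed
  qed (rule c)
  \<comment> \<open>By \<open>walk_sym\<close> the mass on \<open>W\<close> is the walk applied to
    the indicator of \<open>W\<close>, evaluated at \<open>x\<close>. That indicator is at most 1,
    and \<open>walk_le\<close> keeps this bound.\<close>
  have card_le: "real (card W) * c \<le> 1" if W: "finite W" "W \<subseteq> verts Y" for W
  proof (rule LIMSEQ_le_const2)
    have "(\<lambda>n. b n w) \<longlonglongrightarrow> c" if "w \<in> W" for w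
      using that W x conn by (intro lim) (auto simp: connected_graph_def)
    then have "(\<lambda>n. \<Sum>w\<in>W. b n w) \<longlonglongrightarrow> (\<Sum>w\<in>W. c)" by (rule tendsto_sum)
    then show "(\<lambda>n. \<Sum>w\<in>W. b n w) \<longlonglongrightarrow> real (card W) * c" by simp
    have "(\<Sum>w\<in>W. b n w) \<le> 1" for n
    proof -
      have "(\<Sum>w\<in>W. b n w) = (\<Sum>w\<in>W. walk (n + n) (indicator {w}) x)"
        unfolding b_def using W x by (intro sum.cong refl walk_sym) auto
      also have "\<dots> = walk (n + n) (\<lambda>y. \<Sum>w\<in>W. indicator {w} y) x"
        by (simp add: walk_sum[OF W(1)])
      also have "\<dots> \<le> 1"
      proof (rule walk_le[OF _ x])
        fix y
        show "(\<Sum>w\<in>W. indicator {w} y) \<le> (1 :: real)"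
          using card_mono[of "{y}" "W \<inter> {y}"] W(1) by (simp add: indicator_def)
      qed
      finally show ?thesis .
    qed
    then show "\<exists>N. \<forall>n\<ge>N. (\<Sum>w\<in>W. b n w) \<le> 1" by blast
  qed
  have "c = 0"
  proof (rule ccontr)
    assume "c \<noteq> 0"
    with c0 have cpos: "c > 0" by simp
    obtain m :: nat where m: "1 / c < real m" using reals_Archimedean2 by blast
    obtain W where "finite W" "card W = m" "W \<subseteq> verts Y"
      using infinite_arbitrarily_large[OF inf] by blast
    with card_le[of W] have "real m * c \<le> 1" by simp
    with m cpos show False by (simp add: field_simps)
  qed
  with c show ?thesis by (simp add: b_def)
qed

section \<open>The isoperimetric inequality\<close>

lemma green_op_sym:
  assumes "x \<in> verts Y" "y \<in> verts Y"
  shows "green_op N (indicator {x}) y = green_op N (indicator {y}) x"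
  using walk_sym[OF assms] by (simp add: green_op_def)

lemma resistance_loop: "src e = tgt e \<Longrightarrow> resistance N e = 0"
  by (simp add: resistance_def grad_def)

text \<open>A truncated local form of Foster's formula. The Green kernel is symmetric and, by
  transitivity, constant on the diagonal, so the resistances at \<open>x\<close> add up to twice the
  Laplacian of the kernel at \<open>x\<close>.\<close>

lemma sum_resistance:
  assumes tr: "transitive_graph Y" and x: "x \<in> verts Y"
  shows "(\<Sum>e\<in>inc x. resistance N e) = 2 * (1 - walk N (indicator {x}) x)"
proof -
  let ?G = "\<lambda>y. green_op N (indicator {y})"
  have "resistance N e = 2 * (?G x x - ?G x (other e x))" if "e \<in> inc x" for e
  proof -
    have v: "src e \<in> verts Y" "tgt e \<in> verts Y"
      using that by (auto simp: mem_inc src_in_verts tgt_in_verts)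
    have r: "resistance N e = ?G (tgt e) (tgt e) - ?G (src e) (tgt e) - ?G (tgt e) (src e) + ?G (src e) (src e)"
      unfolding resistance_def dipole_def grad_def green_op_lin by simp
    have "?G (src e) (src e) = ?G (tgt e) (tgt e)"
      unfolding green_op_def using walk_return_const[OF tr v] by simp
    then show ?thesis
      using that green_op_sym[OF v, of N] unfolding r by (auto simp: mem_inc other_def)
  qed
  then have "(\<Sum>e\<in>inc x. resistance N e) = 2 * lap (?G x) x"
    by (simp add: lap_eq sum_distrib_left)
  then show ?thesis by (simp add: lap_green_op)
qed

text \<open>Apply \<open>weight_le_distance\<close> to the sum of the dipole gradient and
  \<open>z\<close>, which are orthogonal. The last assumption in \<open>zz\<close> holds when
  \<open>z\<close> is the projection of the edge onto a space of cycles; then the terms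
  \<open>- 2 * z e\<close> and the squared norm of \<open>z\<close> leave
  \<open>- z e\<close>.\<close>

lemma weight_le_cycle:
  assumes e: "e \<in> edges Y" and z: "z \<in> finite_cycles Y src tgt"
    and zz: "finite E" "E \<subseteq> edges Y" "\<And>d. d \<notin> E \<Longrightarrow> z d = 0" "(\<Sum>d\<in>E. z d * z d) = z e"
  shows "weight e \<le> 1 - resistance (N + N) e - z e"
proof -
  let ?k = "green_op N (dipole e)"
  \<comment> \<open>\<open>F\<close> contains \<open>e\<close>, the support of \<open>z\<close> and
    all edges at the support of \<open>?k\<close>, so sums over \<open>F\<close> lose no term of the
    products with \<open>z\<close> or \<open>grad ?k\<close>.\<close>
  define F where "F = insert e (E \<union> (\<Union>x\<in>{x. ?k x \<noteq> 0}. inc x))"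
  have ks: "finsupp ?k"
    unfolding dipole_def
    by (intro finsupp_green_op finsupp_lin finsupp_indicator src_in_verts tgt_in_verts e)
  have F: "finite F" "F \<subseteq> edges Y" "e \<in> F"
    unfolding F_def using ks e zz inc_subset by (auto simp: finsupp_def F_def)
  have h: "harm_proj e \<in> harmonics" by (rule harm_proj(1)[OF e])
  have gz: "(\<Sum>d\<in>F. grad ?k d * z d) = 0"
    using z ks F by (intro grad_orth) (auto simp: finite_cycles_def l2_cycles_def F_def)
  have zsum: "(\<Sum>d\<in>F. z d * z d) = z e"
    unfolding zz(4)[symmetric] using F zz by (intro sum.mono_neutral_right) (auto simp: F_def)
  have iz: "(\<Sum>d\<in>F. indicator {e} d * z d) = z e"
  proof -
    have "(\<Sum>d\<in>F. indicator {e} d * z d) = (\<Sum>d\<in>{e}. indicator {e} d * z d)"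
      using F by (intro sum.mono_neutral_right) auto
    then show ?thesis by simp
  qed
  have "(\<Sum>d\<in>F. grad ?k d * harm_proj e d) = 0"
    using h ks F by (intro grad_orth) (auto simp: harmonic_cycles_def l2_cycles_def F_def)
  moreover have "(\<Sum>d\<in>F. harm_proj e d * z d) = 0"
    using zz by (intro finite_cycle_orth[OF h z F(1,2)]) (auto simp: F_def)
  ultimately have "(\<Sum>d\<in>F. harm_proj e d * (grad ?k d + z d)) = 0"
    by (simp add: distrib_left sum.distrib mult.commute[of "grad ?k _"])
  then have "weight e \<le> (\<Sum>d\<in>F. (indicator {e} d - (grad ?k d + z d))\<^sup>2)"
    by (rule weight_le_distance[OF F])
  also have "\<dots> = (\<Sum>d\<in>F. (indicator {e} d - grad ?k d)\<^sup>2 + (2 * (grad ?k d * z d) + (z d * z d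
      - 2 * (indicator {e} d * z d))))"
    by (intro sum.cong refl) (simp add: power2_eq_square algebra_simps)
  also have "\<dots> = (\<Sum>d\<in>F. (indicator {e} d - grad ?k d)\<^sup>2) - z e"
    unfolding sum.distrib sum_subtractf sum_distrib_left[symmetric] gz zsum iz by simp
  also have "(\<Sum>d\<in>F. (indicator {e} d - grad ?k d)\<^sup>2) = 1 - resistance (N + N) e"
    by (rule distance_to_gradient[OF e F]) (auto simp: F_def)
  finally show ?thesis by simp
qed

lemma weight_le: "e \<in> edges Y \<Longrightarrow> weight e \<le> 1 - resistance (N + N) e"
  using weight_le_cycle[of e "\<lambda>_. 0" "{}" N]
  by (simp add: finite_cycles_def l2_cycles_def l2_chains_def chain_boundary_def)

text \<open>The gain in \<open>weight_le_cycle\<close>, summed over \<open>E\<close>, is the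
  dimension of the cycle space of the subgraph induced on \<open>A\<close>. This is at least the
  number of edges minus the number of vertices, so the edge count cancels.\<close>

lemma sum_weight_interior_le:
  assumes A: "finite A" "A \<subseteq> verts Y" and E: "E = {e \<in> edges Y. src e \<in> A \<and> tgt e \<in> A}"
  shows "(\<Sum>e\<in>E. weight e) \<le> real (card A) - (\<Sum>e\<in>E. resistance (N + N) e)"
proof -
  have "E \<subseteq> (\<Union>x\<in>A. inc x)" unfolding E by (auto simp: mem_inc)
  then have fin: "finite E" using A finite_subset by fastforce
  have sub: "E \<subseteq> edges Y" by (auto simp: E)
  \<comment> \<open>The rows of the incidence matrix; their orthogonal complement in the functions
    on \<open>E\<close> is the cycle space.\<close>
  define r :: "'v \<Rightarrow> 'e \<Rightarrow> real"
    where "r x e = (if tgt e = x then 1 else 0) - (if src e = x then 1 else 0)" for x e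
  obtain z where sym: "\<forall>e\<in>E. \<forall>f\<in>E. z e f = z f e"
    and idem: "\<forall>e\<in>E. \<forall>f\<in>E. (\<Sum>g\<in>E. z e g * z g f) = z e f"
    and orth: "\<forall>x\<in>A. \<forall>e\<in>E. (\<Sum>g\<in>E. z e g * r x g) = 0"
    and trace: "real (card E) - real (card A) \<le> (\<Sum>e\<in>E. z e e)"
    using finite_complement_projection[OF A(1) fin, of r] by (elim exE conjE)
  have "weight e \<le> 1 - resistance (N + N) e - z e e" if e: "e \<in> E" for e
  proof -
    define c where "c d = (if d \<in> E then z e d else 0)" for d
    have "bd c x = 0" if "x \<in> verts Y" for x
    proof -
      have "bd c x = (\<Sum>d\<in>E. (if tgt d = x then c d else 0) - (if src d = x then c d else 0))"
        by (rule bd_eq[OF fin sub]) (simp add: c_def)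
      also have "\<dots> = (\<Sum>d\<in>E. z e d * r x d)"
        by (intro sum.cong) (auto simp: c_def r_def)
      also have "\<dots> = 0"
      \<comment> \<open>No edge of \<open>E\<close> meets a vertex outside \<open>A\<close>, so a
        cycle inside \<open>A\<close>, extended by zero, is a cycle of \<open>Y\<close>.\<close>
      proof (cases "x \<in> A")
        case False
        then show ?thesis by (intro sum.neutral) (auto simp: r_def E)
      qed (use orth e in blast)
      finally show ?thesis .
    qed
    moreover have "finite {d. c d \<noteq> 0}"
      by (rule finite_subset[OF _ fin]) (auto simp: c_def)
    moreover from this have "c \<in> l2_chains Y"
      by (rule finite_support_l2) (use sub in \<open>auto simp: c_def\<close>)
    ultimately have "c \<in> finite_cycles Y src tgt"
      by (simp add: finite_cycles_def l2_cycles_def)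
    moreover have "(\<Sum>d\<in>E. c d * c d) = c e"
    proof -
      have "(\<Sum>d\<in>E. c d * c d) = (\<Sum>d\<in>E. z e d * z d e)"
        using sym e by (intro sum.cong) (auto simp: c_def)
      then show ?thesis using idem e by (simp add: c_def)
    qed
    ultimately have "weight e \<le> 1 - resistance (N + N) e - c e"
      using e sub fin by (intro weight_le_cycle[of e c E]) (auto simp: c_def)
    then show ?thesis using e by (simp add: c_def)
  qed
  then have "(\<Sum>e\<in>E. weight e) \<le> (\<Sum>e\<in>E. 1 - resistance (N + N) e - z e e)" by (rule sum_mono)
  then show ?thesis using trace by (simp add: sum_subtractf)
qed

text \<open>Double counting: an interior edge has two ends in \<open>A\<close>, a boundary edge one.
  A loop is listed only once at its vertex, whence the assumption \<open>loop\<close>.\<close>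

lemma sum_incident_eq:
  assumes A: "finite A" "A \<subseteq> verts Y" and E: "E = {e \<in> edges Y. src e \<in> A \<and> tgt e \<in> A}"
    and loop: "\<And>e. e \<in> edges Y \<Longrightarrow> src e = tgt e \<Longrightarrow> f e = (0 :: real)"
  shows "(\<Sum>x\<in>A. \<Sum>e\<in>inc x. f e) = 2 * (\<Sum>e\<in>E. f e) + (\<Sum>e\<in>edge_boundary Y A. f e)"
proof -
  let ?B = "edge_boundary Y A" and ?U = "\<Union>x\<in>A. inc x"
  have mem_B: "e \<in> ?B \<longleftrightarrow> e \<in> edges Y \<and> (src e \<in> A \<longleftrightarrow> tgt e \<notin> A)" for e
    using ends_eq[of e] unfolding edge_boundary_def by (auto simp: doubleton_eq_iff)
  have U: "finite ?U" "?U = E \<union> ?B" "E \<inter> ?B = {}"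
    using A by (auto simp: mem_B E mem_inc)
  have "(\<Sum>x\<in>A. \<Sum>e\<in>inc x. f e) = (\<Sum>x\<in>A. \<Sum>e\<in>?U. if e \<in> inc x then f e else 0)"
  proof (rule sum.cong[OF refl])
    fix x assume "x \<in> A"
    then show "(\<Sum>e\<in>inc x. f e) = (\<Sum>e\<in>?U. if e \<in> inc x then f e else 0)"
      using U(1) by (intro sum.mono_neutral_cong_left) auto
  qed
  also have "\<dots> = (\<Sum>e\<in>?U. \<Sum>x\<in>A. if e \<in> inc x then f e else 0)" by (rule sum.swap)
  also have "\<dots> = (\<Sum>e\<in>?U. (if src e \<in> A then f e else 0) + (if tgt e \<in> A then f e else 0))"
  proof (intro sum.cong refl)
    fix e assume "e \<in> ?U"
    then have e: "e \<in> edges Y" using inc_subset by blast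
    show "(\<Sum>x\<in>A. if e \<in> inc x then f e else 0) =
        (if src e \<in> A then f e else 0) + (if tgt e \<in> A then f e else 0)"
    proof (cases "src e = tgt e")
      case False
      then have "(\<Sum>x\<in>A. if e \<in> inc x then f e else 0) =
          (\<Sum>x\<in>A. (if src e = x then f e else 0) + (if tgt e = x then f e else 0))"
        using e by (intro sum.cong) (auto simp: mem_inc)
      then show ?thesis using A by (simp add: sum.distrib)
    next
      case True
      then have "f e = 0" by (rule loop[OF e])
      then show ?thesis by (auto intro!: sum.neutral)
    qed
  qed
  also have "\<dots> = (\<Sum>e\<in>E. (if src e \<in> A then f e else 0) + (if tgt e \<in> A then f e else 0))
      + (\<Sum>e\<in>?B. (if src e \<in> A then f e else 0) + (if tgt e \<in> A then f e else 0))"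
    using U(1,3) unfolding U(2) by (intro sum.union_disjoint) auto
  also have "(\<Sum>e\<in>E. (if src e \<in> A then f e else 0) + (if tgt e \<in> A then f e else 0)) = (\<Sum>e\<in>E. 2 * f e)"
    by (intro sum.cong) (auto simp: E)
  also have "(\<Sum>e\<in>?B. (if src e \<in> A then f e else 0) + (if tgt e \<in> A then f e else 0)) = (\<Sum>e\<in>?B. f e)"
    by (intro sum.cong) (auto simp: mem_B)
  finally show ?thesis by (simp add: sum_distrib_left)
qed

text \<open>Apply \<open>sum_incident_eq\<close> to both \<open>weight\<close> and
  \<open>resistance\<close>. Bounding interior and boundary weights separately leaves the total
  resistance over \<open>A\<close> with a minus sign, which \<open>sum_resistance\<close> evaluates;
  this cancels \<open>2 * card A\<close> up to the return probability.\<close>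

lemma sum_weight_le:
  assumes tr: "transitive_graph Y" and A: "finite A" "A \<subseteq> verts Y" and x: "x \<in> verts Y"
  shows "(\<Sum>y\<in>A. \<Sum>e\<in>inc y. weight e)
    \<le> real (card (edge_boundary Y A)) + 2 * real (card A) * walk (N + N) (indicator {x}) x"
proof -
  define E where "E = {e \<in> edges Y. src e \<in> A \<and> tgt e \<in> A}"
  let ?B = "edge_boundary Y A" and ?R = "resistance (N + N)"
  have "2 * (\<Sum>e\<in>E. ?R e) + (\<Sum>e\<in>?B. ?R e) = (\<Sum>y\<in>A. \<Sum>e\<in>inc y. ?R e)"
    by (rule sum_incident_eq[OF A E_def, symmetric]) (rule resistance_loop)
  also have "\<dots> = (\<Sum>y\<in>A. 2 * (1 - walk (N + N) (indicator {x}) x))"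
  proof (rule sum.cong[OF refl])
    fix y assume "y \<in> A"
    then have y: "y \<in> verts Y" using A by blast
    show "(\<Sum>e\<in>inc y. ?R e) = 2 * (1 - walk (N + N) (indicator {x}) x)"
      unfolding sum_resistance[OF tr y] walk_return_const[OF tr y x] ..
  qed
  finally have R: "2 * (\<Sum>e\<in>E. ?R e) + (\<Sum>e\<in>?B. ?R e)
      = 2 * real (card A) - 2 * real (card A) * walk (N + N) (indicator {x}) x"
    by (simp add: algebra_simps)
  have "(\<Sum>y\<in>A. \<Sum>e\<in>inc y. weight e) = 2 * (\<Sum>e\<in>E. weight e) + (\<Sum>e\<in>?B. weight e)"
    by (rule sum_incident_eq[OF A E_def]) (rule weight_loop)
  moreover have "(\<Sum>e\<in>?B. weight e) \<le> (\<Sum>e\<in>?B. 1 - ?R e)"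
    by (intro sum_mono weight_le) (simp add: edge_boundary_def)
  moreover have "(\<Sum>e\<in>?B. 1 - ?R e) = real (card ?B) - (\<Sum>e\<in>?B. ?R e)"
    by (simp add: sum_subtractf)
  ultimately show ?thesis
    using sum_weight_interior_le[OF A E_def, of N] R by linarith
qed

end

theorem corollary7:
  fixes Y :: "('v, 'e) graph"
    and src tgt :: "'e \<Rightarrow> 'v"
    and x :: 'v
  assumes "wf_graph Y"
    and "locally_finite_graph Y"
    and "connected_graph Y"
    and "transitive_graph Y"
    and "orientation Y src tgt"
    and "x \<in> verts Y"
  shows "l2_betti1 Y src tgt x \<le> isoperimetric_constant Y / 2"
proof -
  interpret oriented_graph Y src tgt by standard fact+
  \<comment> \<open>\<open>S\<close> is twice the Betti number, so it has to be bounded by every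
    isoperimetric ratio.\<close>
  define S where "S = (\<Sum>e\<in>inc x. weight e)"
  have "S \<le> real (card (edge_boundary Y A)) / real (card A)"
    if A: "A \<subseteq> verts Y" "finite A" "A \<noteq> {}" for A
  proof (cases "finite (verts Y)")
    case True
    then have "S = 0" unfolding S_def by (intro sum.neutral) (auto simp: mem_inc weight_finite_graph)
    then show ?thesis by simp
  next
    case inf: False
    \<comment> \<open>\<open>sum_weight_automorphism_le\<close> is one-sided; automorphisms in both
      directions between \<open>x\<close> and \<open>y\<close> give equality.\<close>
    have S: "(\<Sum>e\<in>inc y. weight e) = S" if y: "y \<in> verts Y" for y
    proof (rule antisym)
      obtain \<phi> \<psi> where "graph_automorphism Y \<phi> \<psi>" "\<phi> x = y"
        using \<open>transitive_graph Y\<close> \<open>x \<in> verts Y\<close> y unfolding transitive_graph_def by blast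
      then show "(\<Sum>e\<in>inc y. weight e) \<le> S"
        using sum_weight_automorphism_le[of \<phi> \<psi> x] \<open>x \<in> verts Y\<close> by (simp add: S_def)
      obtain \<phi> \<psi> where "graph_automorphism Y \<phi> \<psi>" "\<phi> y = x"
        using \<open>transitive_graph Y\<close> \<open>x \<in> verts Y\<close> y unfolding transitive_graph_def by blast
      then show "S \<le> (\<Sum>e\<in>inc y. weight e)"
        using sum_weight_automorphism_le[of \<phi> \<psi> y] y by (simp add: S_def)
    qed
    \<comment> \<open>The walk needs positive degree: a connected graph with a second vertex has an
      edge at \<open>x\<close>.\<close>
    have "inc x \<noteq> {}"
    proof -
      obtain y where y: "y \<in> verts Y" "y \<noteq> x"
        using inf finite_subset[of "verts Y" "{x}"] by auto
      then have "(x, y) \<in> {(a, b). \<exists>e\<in>edges Y. ends Y e = {a, b}}\<^sup>*"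
        using \<open>connected_graph Y\<close> \<open>x \<in> verts Y\<close> by (simp add: connected_graph_def)
      then show ?thesis
        using y(2) by (cases rule: converse_rtranclE) (auto simp: incident_edges_def)
    qed
    then have D: "0 < real (card (inc x))" by (simp add: card_gt_0_iff)
    have regular: "real (card (inc y)) = real (card (inc x))" if y: "y \<in> verts Y" for y
    proof -
      obtain \<phi> \<psi> where aut: "graph_automorphism Y \<phi> \<psi>" "\<phi> x = y"
        using \<open>transitive_graph Y\<close> \<open>x \<in> verts Y\<close> y unfolding transitive_graph_def by blast
      then show ?thesis
        using bij_betw_same_card[OF automorphism_inc[OF aut(1) \<open>x \<in> verts Y\<close>]] by simp
    qed
    interpret regular_graph Y src tgt "real (card (inc x))"
      by standard (fact D, rule regular)
    let ?p = "\<lambda>n. walk (n + n) (indicator {x}) x"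
    have "real (card A) * S \<le> real (card (edge_boundary Y A)) + 2 * real (card A) * ?p n" for n
    proof -
      have "real (card A) * S = (\<Sum>y\<in>A. \<Sum>e\<in>inc y. weight e)"
        using S A by (simp add: subset_iff)
      also have "\<dots> \<le> real (card (edge_boundary Y A)) + 2 * real (card A) * ?p n"
        by (rule sum_weight_le) fact+
      finally show ?thesis .
    qed
    moreover have "(\<lambda>n. real (card (edge_boundary Y A)) + 2 * real (card A) * ?p n)
        \<longlonglongrightarrow> real (card (edge_boundary Y A)) + 2 * real (card A) * 0"
      by (intro tendsto_intros return_probability_limit inf) fact+
    ultimately have "real (card A) * S \<le> real (card (edge_boundary Y A)) + 2 * real (card A) * 0"
      by (intro LIMSEQ_le_const) auto
    moreover have "card A > 0" using A by (simp add: card_gt_0_iff)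
    ultimately show ?thesis by (simp add: field_simps)
  qed
  moreover have "{A. A \<subseteq> verts Y \<and> finite A \<and> A \<noteq> {}} \<noteq> {}"
    using \<open>x \<in> verts Y\<close> by (auto intro!: exI[of _ "{x}"])
  ultimately have "S \<le> isoperimetric_constant Y"
    unfolding isoperimetric_constant_def by (intro cINF_greatest) auto
  then show ?thesis by (simp add: l2_betti1_eq S_def)
qed

end
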